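(* Let $k\in\mathbb{N}\cup\{\infty\}$ and let $X$ be a Banach space with the property that for every Lipschitz function $f:X\to\mathbb{R}$ and every $\eta>0$, there exists a function $g:X\to\mathbb{R}$ of class $C^k(X)$ such that $|f-g|\leq\eta$ on $X$ and $\mathrm{Lip}(g,B(x_0,r))\leq\mathrm{Lip}(f,B(x_0,r+\eta))+\eta$ for every ball $B(x_0,r)\subset X$. Then, if $\Omega$ is an open subset of $X$, $u_0:\overline{\Omega}\to\mathbb{R}$ is a Lipschitz function such that $\mathrm{Lip}(u_0,\partial\Omega)<\mathrm{Lip}(u_0,\overline{\Omega})$, and $\varepsilon>0$, there exists a function $v:\overline{\Omega}\to\mathbb{R}$ such that $v$ is of class $C^k(\Omega)$, $v$ is Lipschitz on $\overline{\Omega}$ with $\mathrm{Lip}(v,\overline{\Omega})\leq\mathrm{Lip}(u_0,\overline{\Omega})$, $v=u_0$ on $\partial\Omega$, and $|u_0-v|\leq\varepsilon$ on $\overline{\Omega}$.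
   Context: All spaces are real. For a metric space $(E,d)$ and $f:E\to\mathbb{R}$, $\mathrm{Lip}(f,E):=\inf\{L>0 : |f(x)-f(y)|\leq L\,d(x,y)\text{ for all }x,y\in E\}$; for a subset $S$ of the domain of $f$, $\mathrm{Lip}(f,S)$ means the Lipschitz constant of the restriction of $f$ to $S$ (with the distance induced by the norm of $X$). $B(x_0,r)$ denotes the closed ball centered at $x_0$ with radius $r>0$. Smoothness is in the Fréchet sense. *)

theory Defs
  imports "HOL-Analysis.Analysis" "HOL-Library.Extended_Nat"
begin

text \<open>The infimum is taken in the extended reals, so that a function which is not Lipschitz on
  \<open>S\<close> has constant \<open>\<infinity>\<close>.\<close>

definition Lip :: "('a::metric_space \<Rightarrow> real) \<Rightarrow> 'a set \<Rightarrow> ereal" where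
  "Lip f S = Inf {ereal L | L. 0 < L \<and> (\<forall>x\<in>S. \<forall>y\<in>S. \<bar>f x - f y\<bar> \<le> L * dist x y)}"

text \<open>
  Iterated Frechet derivatives live in a tower of spaces of bounded \<open>j\<close>-linear maps whose HOL types
  depend on \<open>j\<close>. To quantify over \<open>j\<close>, a \<open>j\<close>-linear map is represented by a function
  on lists, of which only the values on lists of length \<open>j\<close> matter. For \<open>K \<ge> 0\<close>,
  \<open>mlin_norm_le j m K\<close> says that the operator norm of \<open>m\<close> is at most \<open>K\<close>.
\<close>

definition mlin_norm_le ::
  "nat \<Rightarrow> ('a::real_normed_vector list \<Rightarrow> 'b::real_normed_vector) \<Rightarrow> real \<Rightarrow> bool" where
  "mlin_norm_le j m K \<longleftrightarrow> (\<forall>vs. length vs = j \<longrightarrow> norm (m vs) \<le> K * prod_list (map norm vs))"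

definition bounded_multilinear ::
  "nat \<Rightarrow> ('a::real_normed_vector list \<Rightarrow> 'b::real_normed_vector) \<Rightarrow> bool" where
  "bounded_multilinear j m \<longleftrightarrow>
     (\<forall>us vs. length us + 1 + length vs = j \<longrightarrow> linear (\<lambda>v. m (us @ v # vs))) \<and>
     (\<exists>K. mlin_norm_le j m K)"

text \<open>
  \<open>D j x\<close> is the \<open>j\<close>-th derivative of \<open>f\<close> at \<open>x\<close>: for \<open>j < n\<close> the map \<open>D j\<close> is Frechet
  differentiable in operator norm, its derivative being \<open>h \<mapsto> D (j + 1) x (h # _)\<close>, and
  \<open>D n\<close> is continuous in operator norm. Meant for open \<open>U\<close>. The lemmas \<open>Cn_on_0\<close> and \<open>Cn_on_Suc\<close>
  below show that this is the usual recursive notion for maps between normed spaces.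
\<close>

definition derivatives_on :: "nat \<Rightarrow> ('a::real_normed_vector \<Rightarrow> 'b::real_normed_vector) \<Rightarrow> 'a set \<Rightarrow>
    (nat \<Rightarrow> 'a \<Rightarrow> 'a list \<Rightarrow> 'b) \<Rightarrow> bool" where
  "derivatives_on n f U D \<longleftrightarrow>
     (\<forall>x\<in>U. D 0 x [] = f x) \<and>
     (\<forall>j\<le>n. \<forall>x\<in>U. bounded_multilinear j (D j x)) \<and>
     (\<forall>j<n. \<forall>x\<in>U. \<forall>e>0. \<forall>\<^sub>F y in at x within U.
        mlin_norm_le j (\<lambda>vs. D j y vs - D j x vs - D (Suc j) x ((y - x) # vs)) (e * norm (y - x))) \<and>
     (\<forall>x\<in>U. \<forall>e>0. \<forall>\<^sub>F y in at x within U. mlin_norm_le n (\<lambda>vs. D n y vs - D n x vs) e)"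

definition Cn_on ::
  "nat \<Rightarrow> ('a::real_normed_vector \<Rightarrow> 'b::real_normed_vector) \<Rightarrow> 'a set \<Rightarrow> bool" where
  "Cn_on n f U \<longleftrightarrow> (\<exists>D. derivatives_on n f U D)"

definition Ck_on ::
  "enat \<Rightarrow> ('a::real_normed_vector \<Rightarrow> 'b::real_normed_vector) \<Rightarrow> 'a set \<Rightarrow> bool" where
  "Ck_on k f U \<longleftrightarrow> (case k of enat n \<Rightarrow> Cn_on n f U | \<infinity> \<Rightarrow> \<forall>n. Cn_on n f U)"

lemma Cn_on_0: "Cn_on 0 f U \<longleftrightarrow> continuous_on U f"
proof
  assume "Cn_on 0 f U"
  then obtain D :: "nat \<Rightarrow> 'a \<Rightarrow> 'a list \<Rightarrow> 'b" where D0: "\<forall>x\<in>U. D 0 x [] = f x"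
    and Dc: "\<forall>x\<in>U. \<forall>e>0. \<forall>\<^sub>F y in at x within U. mlin_norm_le 0 (\<lambda>vs. D 0 y vs - D 0 x vs) e"
    unfolding Cn_on_def derivatives_on_def by auto
  show "continuous_on U f"
    unfolding continuous_on_def tendsto_iff
  proof (intro ballI allI impI)
    fix x e assume x: "x \<in> U" and e: "(0::real) < e"
    then have "\<forall>\<^sub>F y in at x within U. mlin_norm_le 0 (\<lambda>vs. D 0 y vs - D 0 x vs) (e / 2)"
      using Dc by simp
    moreover have "\<forall>\<^sub>F y in at x within U. y \<in> U"
      by (simp add: eventually_at_filter)
    ultimately show "\<forall>\<^sub>F y in at x within U. dist (f y) (f x) < e"
      by eventually_elim (use x e D0 in \<open>auto simp: mlin_norm_le_def dist_norm\<close>)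
  qed
next
  assume c: "continuous_on U f"
  have "\<forall>\<^sub>F y in at x within U. mlin_norm_le 0 (\<lambda>vs. f y - f x) e" if "x \<in> U" "e > 0" for x e
  proof -
    have "\<forall>\<^sub>F y in at x within U. dist (f y) (f x) < e"
      using c that unfolding continuous_on_def tendsto_iff by blast
    then show ?thesis
      by eventually_elim (auto simp: mlin_norm_le_def dist_norm)
  qed
  moreover have "bounded_multilinear 0 (\<lambda>vs. f x)" for x
    by (auto simp: bounded_multilinear_def mlin_norm_le_def)
  ultimately show "Cn_on 0 f U"
    unfolding Cn_on_def derivatives_on_def by (intro exI[of _ "\<lambda>j x vs. f x"]) auto
qed

lemma bounded_multilinear_last:
  assumes "bounded_multilinear (Suc j) m" "length vs = j"
  shows "bounded_linear (\<lambda>h. m (vs @ [h]))"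
proof -
  obtain K where K: "mlin_norm_le (Suc j) m K"
    using assms by (auto simp: bounded_multilinear_def)
  have "linear (\<lambda>h. m (vs @ [h]))"
    using assms unfolding bounded_multilinear_def by force
  moreover have "norm (m (vs @ [h])) \<le> norm h * (K * prod_list (map norm vs))" for h
    using K assms(2) unfolding mlin_norm_le_def
    by (auto simp: mult_ac dest!: spec[of _ "vs @ [h]"])
  ultimately show ?thesis
    by (intro bounded_linear_intro[where K = "K * prod_list (map norm vs)"])
      (auto simp: linear_iff)
qed

lemma mlin_norm_le_curry:
  fixes B :: "'a::real_normed_vector list \<Rightarrow> 'a \<Rightarrow>\<^sub>L 'b::real_normed_vector"
  assumes "K \<ge> 0"
  shows "mlin_norm_le j B K \<longleftrightarrow> mlin_norm_le (Suc j) (\<lambda>vs. blinfun_apply (B (butlast vs)) (last vs)) K"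
proof
  assume B: "mlin_norm_le j B K"
  show "mlin_norm_le (Suc j) (\<lambda>vs. blinfun_apply (B (butlast vs)) (last vs)) K"
    unfolding mlin_norm_le_def
  proof (intro allI impI)
    fix vs :: "'a list" assume l: "length vs = Suc j"
    then obtain us h where vs: "vs = us @ [h]"
      by (metis append_butlast_last_id length_0_conv nat.distinct(1))
    have "norm (blinfun_apply (B us) h) \<le> norm (B us) * norm h"
      by (rule norm_blinfun)
    also have "\<dots> \<le> (K * prod_list (map norm us)) * norm h"
      using B l vs by (intro mult_right_mono) (auto simp: mlin_norm_le_def)
    finally show "norm (blinfun_apply (B (butlast vs)) (last vs)) \<le> K * prod_list (map norm vs)"
      by (simp add: vs mult_ac)
  qed
next
  assume B: "mlin_norm_le (Suc j) (\<lambda>vs. blinfun_apply (B (butlast vs)) (last vs)) K"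
  show "mlin_norm_le j B K"
    unfolding mlin_norm_le_def
  proof (intro allI impI norm_blinfun_bound)
    fix vs :: "'a list" and h assume l: "length vs = j"
    show "0 \<le> K * prod_list (map norm vs)"
      using assms by (intro mult_nonneg_nonneg prod_list_nonneg) auto
    show "norm (blinfun_apply (B vs) h) \<le> K * prod_list (map norm vs) * norm h"
      using B l unfolding mlin_norm_le_def by (auto simp: mult_ac dest!: spec[of _ "vs @ [h]"])
  qed
qed

lemma mlin_norm_le_mono:
  assumes "mlin_norm_le j m K" "K \<le> L"
  shows "mlin_norm_le j m L"
  unfolding mlin_norm_le_def
proof (intro allI impI)
  fix vs :: "'a list" assume "length vs = j"
  then have "norm (m vs) \<le> K * prod_list (map norm vs)"
    using assms by (simp add: mlin_norm_le_def)
  also have "\<dots> \<le> L * prod_list (map norm vs)"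
    using assms by (intro mult_right_mono prod_list_nonneg) auto
  finally show "norm (m vs) \<le> L * prod_list (map norm vs)" .
qed

lemma mlin_norm_le_nonneg: "(\<exists>K. mlin_norm_le j m K) \<longleftrightarrow> (\<exists>K\<ge>0. mlin_norm_le j m K)"
proof
  assume "\<exists>K. mlin_norm_le j m K"
  then obtain K where "mlin_norm_le j m K" ..
  then have "mlin_norm_le j m \<bar>K\<bar>"
    by (rule mlin_norm_le_mono) simp
  then show "\<exists>K\<ge>0. mlin_norm_le j m K"
    by (intro exI[of _ "\<bar>K\<bar>"]) simp
qed blast

lemma bounded_multilinear_curry:
  fixes B :: "'a::real_normed_vector list \<Rightarrow> 'a \<Rightarrow>\<^sub>L 'b::real_normed_vector"
  shows "bounded_multilinear j B \<longleftrightarrow>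
    bounded_multilinear (Suc j) (\<lambda>vs. blinfun_apply (B (butlast vs)) (last vs))"
    (is "_ \<longleftrightarrow> bounded_multilinear _ ?m")
proof -
  have bd: "(\<exists>K. mlin_norm_le j B K) \<longleftrightarrow> (\<exists>K. mlin_norm_le (Suc j) ?m K)"
  proof -
    have "(\<exists>K. mlin_norm_le j B K) \<longleftrightarrow> (\<exists>K\<ge>0. mlin_norm_le j B K)"
      by (rule mlin_norm_le_nonneg)
    also have "\<dots> \<longleftrightarrow> (\<exists>K\<ge>0. mlin_norm_le (Suc j) ?m K)"
      using mlin_norm_le_curry by blast
    also have "\<dots> \<longleftrightarrow> (\<exists>K. mlin_norm_le (Suc j) ?m K)"
      by (rule mlin_norm_le_nonneg[symmetric])
    finally show ?thesis .
  qed
  have "(\<forall>us vs. length us + 1 + length vs = j \<longrightarrow> linear (\<lambda>v. B (us @ v # vs))) \<longleftrightarrow>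
    (\<forall>us vs. length us + 1 + length vs = Suc j \<longrightarrow> linear (\<lambda>v. ?m (us @ v # vs)))"
    (is "?L \<longleftrightarrow> ?R")
  proof
    assume L: ?L
    show ?R
    proof (intro allI impI)
      fix us vs :: "'a list" assume l: "length us + 1 + length vs = Suc j"
      show "linear (\<lambda>v. ?m (us @ v # vs))"
      proof (cases vs rule: rev_cases)
        case Nil
        then show ?thesis
          by (simp add: blinfun.bounded_linear_right bounded_linear.linear)
      next
        case (snoc ws h)
        then have "linear (\<lambda>v. B (us @ v # ws))"
          using L l by auto
        then have "linear (\<lambda>v. blinfun_apply (B (us @ v # ws)) h)"
          by (auto simp: linear_iff blinfun.add_left blinfun.scaleR_left)
        then show ?thesis
          using snoc by (simp add: butlast_append)
      qed
    qed
  next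
    assume R: ?R
    show ?L
    proof (intro allI impI)
      fix us vs :: "'a list" assume l: "length us + 1 + length vs = j"
      have "linear (\<lambda>v. blinfun_apply (B (us @ v # vs)) h)" for h
      proof -
        have "linear (\<lambda>v. ?m (us @ v # (vs @ [h])))"
          using R[rule_format, of us "vs @ [h]"] l by simp
        then show ?thesis
          by (simp add: butlast_append)
      qed
      then show "linear (\<lambda>v. B (us @ v # vs))"
        by (auto simp: linear_iff blinfun.add_left blinfun.scaleR_left intro!: blinfun_eqI)
    qed
  qed
  with bd show ?thesis
    by (simp add: bounded_multilinear_def)
qed

lemma mlin_norm_le_cong:
  assumes "\<forall>vs. length vs = j \<longrightarrow> m vs = m' vs"
  shows "mlin_norm_le j m K \<longleftrightarrow> mlin_norm_le j m' K"
  using assms by (simp add: mlin_norm_le_def)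

lemma bounded_multilinear_cong:
  assumes "\<forall>vs. length vs = j \<longrightarrow> m vs = m' vs"
  shows "bounded_multilinear j m \<longleftrightarrow> bounded_multilinear j m'"
proof -
  have "(\<lambda>v. m (us @ v # vs)) = (\<lambda>v. m' (us @ v # vs))"
    if "length us + 1 + length vs = j" for us vs
    using assms that by auto
  then have "(\<forall>us vs. length us + 1 + length vs = j \<longrightarrow> linear (\<lambda>v. m (us @ v # vs))) \<longleftrightarrow>
    (\<forall>us vs. length us + 1 + length vs = j \<longrightarrow> linear (\<lambda>v. m' (us @ v # vs)))"
    by (intro all_cong1 imp_cong refl) simp
  moreover have "mlin_norm_le j m = mlin_norm_le j m'"
    by (intro ext mlin_norm_le_cong assms)
  ultimately show ?thesis
    unfolding bounded_multilinear_def by (simp only:)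
qed

lemma has_derivative_iff_mlin:
  assumes "bounded_linear A" "x \<in> U" "open U"
  shows "(f has_derivative A) (at x) \<longleftrightarrow>
    (\<forall>e>0. \<forall>\<^sub>F y in at x within U. norm (f y - f x - A (y - x)) \<le> e * norm (y - x))"
  unfolding at_within_open[OF assms(2,3)] has_derivative_within_alt2 using assms(1) by blast

lemma Cn_on_Suc:
  fixes f :: "'a::real_normed_vector \<Rightarrow> 'b::real_normed_vector"
  assumes "open U"
  shows "Cn_on (Suc n) f U \<longleftrightarrow>
    (\<exists>f' :: 'a \<Rightarrow> 'a \<Rightarrow>\<^sub>L 'b. (\<forall>x\<in>U. (f has_derivative blinfun_apply (f' x)) (at x)) \<and> Cn_on n f' U)"
    (is "_ \<longleftrightarrow> ?R")
proof
  assume "Cn_on (Suc n) f U"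
  then obtain D where D: "derivatives_on (Suc n) f U D"
    by (auto simp: Cn_on_def)
  have D0: "\<And>x. x \<in> U \<Longrightarrow> D 0 x [] = f x"
    and Dm: "\<And>j x. j \<le> Suc n \<Longrightarrow> x \<in> U \<Longrightarrow> bounded_multilinear j (D j x)"
    and Dd: "\<And>j x e. j < Suc n \<Longrightarrow> x \<in> U \<Longrightarrow> e > 0 \<Longrightarrow> \<forall>\<^sub>F y in at x within U.
        mlin_norm_le j (\<lambda>vs. D j y vs - D j x vs - D (Suc j) x ((y - x) # vs)) (e * norm (y - x))"
    and Dc: "\<And>x e. x \<in> U \<Longrightarrow> e > 0 \<Longrightarrow>
        \<forall>\<^sub>F y in at x within U. mlin_norm_le (Suc n) (\<lambda>vs. D (Suc n) y vs - D (Suc n) x vs) e"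
    using D unfolding derivatives_on_def by simp_all
  define E :: "nat \<Rightarrow> 'a \<Rightarrow> 'a list \<Rightarrow> 'a \<Rightarrow>\<^sub>L 'b"
    where "E j x vs = Blinfun (\<lambda>h. D (Suc j) x (vs @ [h]))" for j x vs
  have E: "blinfun_apply (E j x vs) h = D (Suc j) x (vs @ [h])"
    if "j \<le> n" "x \<in> U" "length vs = j" for j x vs h
    unfolding E_def using that bounded_multilinear_last[OF Dm[of "Suc j" x]]
    by (subst bounded_linear_Blinfun_apply) auto
  have E': "blinfun_apply (E j x (butlast vs)) (last vs) = D (Suc j) x vs"
    if "j \<le> n" "x \<in> U" "length vs = Suc j" for j x vs
  proof -
    have "vs \<noteq> []" using that by auto
    then show ?thesis
      using that E[of j x "butlast vs" "last vs"] by simp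
  qed
  have U: "\<forall>\<^sub>F y in at x within U. y \<in> U" for x
    by (simp add: eventually_at_filter)
  have "(f has_derivative blinfun_apply (E 0 x [])) (at x)" if x: "x \<in> U" for x
    unfolding has_derivative_iff_mlin[OF blinfun.bounded_linear_right x assms]
  proof (intro allI impI)
    fix e :: real assume "e > 0"
    from U Dd[of 0, OF _ x this, simplified]
    show "\<forall>\<^sub>F y in at x within U.
      norm (f y - f x - blinfun_apply (E 0 x []) (y - x)) \<le> e * norm (y - x)"
      by eventually_elim (auto simp: mlin_norm_le_def D0 E x)
  qed
  moreover have "Cn_on n (\<lambda>x. E 0 x []) U"
    unfolding Cn_on_def derivatives_on_def
  proof (intro exI[of _ E] conjI allI impI ballI)
    show "E 0 x [] = E 0 x []" for x ..
    show "bounded_multilinear j (E j x)" if "j \<le> n" "x \<in> U" for j x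
      unfolding bounded_multilinear_curry
      using Dm[of "Suc j" x] that by (subst bounded_multilinear_cong[where m' = "D (Suc j) x"]) (auto simp: E')
    show "\<forall>\<^sub>F y in at x within U. mlin_norm_le j
        (\<lambda>vs. E j y vs - E j x vs - E (Suc j) x ((y - x) # vs)) (e * norm (y - x))"
      if j: "j < n" and x: "x \<in> U" and e: "e > 0" for j x e
    proof -
      have "Suc j < Suc n" using j by simp
      from U Dd[OF this x e] show ?thesis
      proof eventually_elim
        case (elim y)
        have "\<forall>vs. length vs = Suc j \<longrightarrow>
              blinfun_apply (E j y (butlast vs) - E j x (butlast vs)
              - E (Suc j) x ((y - x) # butlast vs)) (last vs)
            = D (Suc j) y vs - D (Suc j) x vs - D (Suc (Suc j)) x ((y - x) # vs)"
          (is "\<forall>vs. _ \<longrightarrow> ?eq vs")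
        proof (intro allI impI)
          fix vs :: "'a list" assume that: "length vs = Suc j"
          have "vs \<noteq> []" using that by auto
          then have "((y - x) # butlast vs) @ [last vs] = (y - x) # vs" by simp
          then show "?eq vs"
            using j x elim that E'[of j y vs] E'[of j x vs]
              E[of "Suc j" x "(y - x) # butlast vs" "last vs"]
            by (simp add: blinfun.diff_left)
        qed
        note c = mlin_norm_le_cong[of "Suc j", OF this]
        have K: "0 \<le> e * norm (y - x)" using e by simp
        show ?case
          unfolding mlin_norm_le_curry[OF K] c by (rule elim(2))
      qed
    qed
    show "\<forall>\<^sub>F y in at x within U. mlin_norm_le n (\<lambda>vs. E n y vs - E n x vs) e"
      if x: "x \<in> U" and e: "e > 0" for x e
      using U Dc[OF x e]
    proof eventually_elim
      case (elim y)
      have "\<forall>vs. length vs = Suc n \<longrightarrow>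
          blinfun_apply (E n y (butlast vs) - E n x (butlast vs)) (last vs)
          = D (Suc n) y vs - D (Suc n) x vs"
        using x elim by (simp add: E' blinfun.diff_left)
      note c = mlin_norm_le_cong[of "Suc n", OF this]
      have K: "0 \<le> e" using e by simp
      show ?case
        unfolding mlin_norm_le_curry[OF K] c by (rule elim(2))
    qed
  qed
  ultimately show ?R
    by (intro exI[of _ "\<lambda>x. E 0 x []"] conjI ballI)
next
  assume ?R
  then obtain f' :: "'a \<Rightarrow> 'a \<Rightarrow>\<^sub>L 'b"
    where *: "(\<forall>x\<in>U. (f has_derivative blinfun_apply (f' x)) (at x)) \<and> Cn_on n f' U" ..
  then have f': "\<And>x. x \<in> U \<Longrightarrow> (f has_derivative blinfun_apply (f' x)) (at x)"
    by simp
  obtain E where E: "derivatives_on n f' U E"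
    using conjunct2[OF *] unfolding Cn_on_def ..
  have E0: "\<And>x. x \<in> U \<Longrightarrow> E 0 x [] = f' x"
    and Em: "\<And>j x. j \<le> n \<Longrightarrow> x \<in> U \<Longrightarrow> bounded_multilinear j (E j x)"
    and Ed: "\<And>j x e. j < n \<Longrightarrow> x \<in> U \<Longrightarrow> e > 0 \<Longrightarrow> \<forall>\<^sub>F y in at x within U.
        mlin_norm_le j (\<lambda>vs. E j y vs - E j x vs - E (Suc j) x ((y - x) # vs)) (e * norm (y - x))"
    and Ec: "\<And>x e. x \<in> U \<Longrightarrow> e > 0 \<Longrightarrow>
        \<forall>\<^sub>F y in at x within U. mlin_norm_le n (\<lambda>vs. E n y vs - E n x vs) e"
    using E unfolding derivatives_on_def by simp_all
  define D :: "nat \<Rightarrow> 'a \<Rightarrow> 'a list \<Rightarrow> 'b" where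
    "D j x vs = (case j of 0 \<Rightarrow> f x | Suc i \<Rightarrow> blinfun_apply (E i x (butlast vs)) (last vs))" for j x vs
  show "Cn_on (Suc n) f U"
    unfolding Cn_on_def derivatives_on_def
  proof (intro exI[of _ D] conjI allI impI ballI)
    show "D 0 x [] = f x" for x by (simp add: D_def)
    show "bounded_multilinear j (D j x)" if "j \<le> Suc n" "x \<in> U" for j x
    proof (cases j)
      case 0
      then show ?thesis by (auto simp: D_def bounded_multilinear_def mlin_norm_le_def)
    next
      case (Suc i)
      then show ?thesis
        using Em[of i x] that unfolding bounded_multilinear_curry by (simp add: D_def[abs_def])
    qed
    show "\<forall>\<^sub>F y in at x within U. mlin_norm_le j
        (\<lambda>vs. D j y vs - D j x vs - D (Suc j) x ((y - x) # vs)) (e * norm (y - x))"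
      if j: "j < Suc n" and x: "x \<in> U" and e: "e > 0" for j x e
    proof (cases j)
      case 0
      have "\<forall>\<^sub>F y in at x within U. norm (f y - f x - blinfun_apply (f' x) (y - x)) \<le> e * norm (y - x)"
        using f'[OF x] e has_derivative_iff_mlin[OF blinfun.bounded_linear_right x assms] by blast
      then show ?thesis
        by eventually_elim (auto simp: 0 D_def mlin_norm_le_def E0 x)
    next
      case (Suc i)
      then have "i < n" using j by simp
      from Ed[OF this x e] show ?thesis
      proof eventually_elim
        case (elim y)
        have "\<forall>vs. length vs = Suc i \<longrightarrow>
              D j y vs - D j x vs - D (Suc j) x ((y - x) # vs) =
            blinfun_apply (E i y (butlast vs) - E i x (butlast vs)
              - E (Suc i) x ((y - x) # butlast vs)) (last vs)"
          (is "\<forall>vs. _ \<longrightarrow> ?eq vs")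
        proof (intro allI impI)
          fix vs :: "'a list" assume that: "length vs = Suc i"
          have "vs \<noteq> []" using that by auto
          then show "?eq vs" by (simp add: D_def Suc blinfun.diff_left)
        qed
        note c = mlin_norm_le_cong[of "Suc i", OF this]
        have "0 \<le> e * norm (y - x)" using e by simp
        from mlin_norm_le_curry[THEN iffD1, OF this elim] show ?case
          by (simp only: c[folded Suc] Suc[symmetric])
      qed
    qed
    show "\<forall>\<^sub>F y in at x within U. mlin_norm_le (Suc n) (\<lambda>vs. D (Suc n) y vs - D (Suc n) x vs) e"
      if x: "x \<in> U" and e: "e > 0" for x e
      using Ec[OF x e]
    proof eventually_elim
      case (elim y)
      have "0 \<le> e" using e by simp
      from mlin_norm_le_curry[THEN iffD1, OF this elim] show ?case
        by (simp add: D_def blinfun.diff_left)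
    qed
  qed
qed

end

theory Submission
  imports Defs
begin

text \<open>
  Let \<open>K\<close> be the Lipschitz constant of \<open>u0\<close> on \<open>closure \<Omega>\<close> and \<open>K0 < K\<close> the one on \<open>frontier \<Omega>\<close>.
  A smooth approximation supplied by the hypothesis may increase a Lipschitz constant, so smoothing
  \<open>u0\<close> itself could exceed \<open>K\<close>. The strict inequality pays for this: \<open>u0\<close> can first be replaced by a
  nearby \<open>w\<close> on the whole space with the same boundary values whose Lipschitz constant is strictly
  below \<open>K\<close> on every ball, although not uniformly so
  (\<open>locally_below_constant_approximation\<close>). There are two ingredients. The composition of \<open>u0\<close> with a
  function \<open>\<psi> \<ge> id\<close> of derivative below 1 lowers the constants but moves the boundary values up. A
  McShane type extension of the boundary values, in which the cone \<open>K * dist x y\<close> is replaced by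
  \<open>\<theta> (dist x y)\<close> with \<open>\<theta>' < K\<close> and \<open>\<theta>\<close> within \<open>\<epsilon>\<close> of \<open>K * t\<close>, has the right boundary values and is at
  least \<open>u0 - \<epsilon>\<close>. The minimum of the two is \<open>w\<close>.

  Let \<open>q\<close> be a 1-Lipschitz function, positive exactly on \<open>\<Omega>\<close>, whose superlevel sets of positive level
  are bounded. On each such set \<open>w\<close> leaves a positive gap below \<open>K\<close>. Smooth approximations of \<open>w\<close>, better
  and better as \<open>q\<close> decreases, are glued along the level sets of \<open>q\<close> by smooth cutoffs. The errors are so
  small that neither the approximation nor the gluing uses up the gap, and that they are bounded by \<open>q\<close>
  (\<open>smooth_perturbation\<close>). The result is smooth on \<open>\<Omega>\<close>, locally \<open>K\<close>-Lipschitz there, and extends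
  continuously by \<open>u0\<close> to the frontier.

  These local bounds are global ones: a segment between two points of \<open>closure \<Omega>\<close> either stays in \<open>\<Omega>\<close>,
  or it can be cut at frontier points, between which the function is \<open>u0\<close>
  (\<open>lipschitz_on_closure_of_local\<close>).

  The cutoffs are composed from \<open>exp (- 1 / t)\<close> and approximations of \<open>q\<close>, so the gluing requires
  that \<open>C\<^sup>k\<close> functions are closed under products and under composition with smooth real functions, and that
  being \<open>C\<^sup>k\<close> is a local property.
\<close>

section \<open>Multilinear forms of class C^n\<close>

definition form_cont :: "nat \<Rightarrow> ('a::real_normed_vector \<Rightarrow> 'a list \<Rightarrow> real) \<Rightarrow> 'a \<Rightarrow> bool" where
  "form_cont j A x \<longleftrightarrow> (\<forall>e>0. \<forall>\<^sub>F y in at x. mlin_norm_le j (\<lambda>vs. A y vs - A x vs) e)"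

definition form_deriv ::
  "nat \<Rightarrow> ('a::real_normed_vector \<Rightarrow> 'a list \<Rightarrow> real) \<Rightarrow> ('a list \<Rightarrow> real) \<Rightarrow> 'a \<Rightarrow> bool" where
  "form_deriv j A A' x \<longleftrightarrow>
     (\<forall>e>0. \<forall>\<^sub>F y in at x. mlin_norm_le j (\<lambda>vs. A y vs - A x vs - A' ((y - x) # vs)) (e * norm (y - x)))"

text \<open>The usual recursion for \<open>C\<^sup>n\<close> (\<open>Cn_on_Suc\<close>) changes the codomain from \<open>'b\<close> to \<open>'a \<Rightarrow>\<^sub>L 'b\<close>, which rules
  out inductions on \<open>n\<close> that use the induction hypothesis for the derivative. Here the codomain is always
  a space of \<open>j\<close>-linear forms represented on lists, and only the number \<open>j\<close> grows.\<close>

fun forms_Cn :: "nat \<Rightarrow> nat \<Rightarrow> ('a::real_normed_vector \<Rightarrow> 'a list \<Rightarrow> real) \<Rightarrow> 'a set \<Rightarrow> bool" where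
  "forms_Cn 0 j A U \<longleftrightarrow> (\<forall>x\<in>U. bounded_multilinear j (A x) \<and> form_cont j A x)"
| "forms_Cn (Suc n) j A U \<longleftrightarrow> (\<forall>x\<in>U. bounded_multilinear j (A x)) \<and>
     (\<exists>A'. (\<forall>x\<in>U. form_deriv j A (A' x) x) \<and> forms_Cn n (Suc j) A' U)"

lemma forms_Cn_multilinear: "forms_Cn n j A U \<Longrightarrow> x \<in> U \<Longrightarrow> bounded_multilinear j (A x)"
  by (cases n) auto

lemma bounded_multilinear_norm:
  assumes "bounded_multilinear j m"
  obtains K where "K > 0" "mlin_norm_le j m K"
proof -
  obtain K where "mlin_norm_le j m K"
    using assms by (auto simp: bounded_multilinear_def)
  then have "mlin_norm_le j m (max K 1)"
    by (rule mlin_norm_le_mono) simp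
  then show ?thesis
    by (intro that[of "max K 1"]) auto
qed

lemma form_cont_cong:
  assumes "open U" "x \<in> U" "\<And>y vs. y \<in> U \<Longrightarrow> length vs = j \<Longrightarrow> A y vs = B y vs" "form_cont j A x"
  shows "form_cont j B x"
  unfolding form_cont_def
proof (intro allI impI)
  fix e :: real assume "e > 0"
  then have "\<forall>\<^sub>F y in at x. mlin_norm_le j (\<lambda>vs. A y vs - A x vs) e"
    using assms(4) by (simp add: form_cont_def)
  moreover have "\<forall>\<^sub>F y in at x. y \<in> U"
    using assms(1,2) by (simp add: eventually_at_in_open')
  ultimately show "\<forall>\<^sub>F y in at x. mlin_norm_le j (\<lambda>vs. B y vs - B x vs) e"
    by eventually_elim (use assms(2,3) in \<open>simp add: mlin_norm_le_def\<close>)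
qed

lemma form_deriv_cong:
  assumes "open U" "x \<in> U" "\<And>y vs. y \<in> U \<Longrightarrow> length vs = j \<Longrightarrow> A y vs = B y vs" "form_deriv j A A' x"
    "\<And>vs. length vs = Suc j \<Longrightarrow> A' vs = B' vs"
  shows "form_deriv j B B' x"
  unfolding form_deriv_def
proof (intro allI impI)
  fix e :: real assume "e > 0"
  then have "\<forall>\<^sub>F y in at x. mlin_norm_le j (\<lambda>vs. A y vs - A x vs - A' ((y - x) # vs)) (e * norm (y - x))"
    using assms(4) by (simp add: form_deriv_def)
  moreover have "\<forall>\<^sub>F y in at x. y \<in> U"
    using assms(1,2) by (simp add: eventually_at_in_open')
  ultimately show "\<forall>\<^sub>F y in at x. mlin_norm_le j (\<lambda>vs. B y vs - B x vs - B' ((y - x) # vs)) (e * norm (y - x))"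
    by eventually_elim (use assms(2,3,5) in \<open>simp add: mlin_norm_le_def\<close>)
qed

lemma forms_Cn_cong:
  assumes "open U" "\<And>y vs. y \<in> U \<Longrightarrow> length vs = j \<Longrightarrow> A y vs = B y vs" "forms_Cn n j A U"
  shows "forms_Cn n j B U"
proof -
  have m: "bounded_multilinear j (B x)" if "x \<in> U" for x
    using forms_Cn_multilinear[OF assms(3) that] bounded_multilinear_cong[of j "A x" "B x"] assms(2) that
    by simp
  show ?thesis
  proof (cases n)
    case 0
    then show ?thesis
      using assms m form_cont_cong[of U _ j A B] by auto
  next
    case (Suc i)
    then obtain A' where "\<forall>x\<in>U. form_deriv j A (A' x) x" and A': "forms_Cn i (Suc j) A' U"
      using assms(3) by auto
    then have "\<forall>x\<in>U. form_deriv j B (A' x) x"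
      by (auto intro!: form_deriv_cong[where A = A and B = B, OF assms(1)] assms(2))
    with A' m Suc show ?thesis by auto
  qed
qed

lemma Cn_on_iff_forms:
  fixes f :: "'a::real_normed_vector \<Rightarrow> real"
  assumes "open U"
  shows "Cn_on n f U \<longleftrightarrow> forms_Cn n 0 (\<lambda>x vs. f x) U"
proof -
  have at: "at x within U = at x" if "x \<in> U" for x
    using that assms by (rule at_within_open)
  show ?thesis
  proof
    assume "Cn_on n f U"
    then obtain D where D: "derivatives_on n f U D"
      unfolding Cn_on_def by blast
    \<comment> \<open>From the highest derivative downwards: the \<open>(n - i)\<close>-th one can be differentiated \<open>i\<close> more times.\<close>
    have "forms_Cn i (n - i) (D (n - i)) U" if "i \<le> n" for i
      using that
    proof (induction i)
      case 0
      then show ?case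
        using D by (simp add: derivatives_on_def form_cont_def at)
    next
      case (Suc i)
      then have "Suc (n - Suc i) = n - i" by simp
      moreover have "form_deriv (n - Suc i) (D (n - Suc i)) (D (Suc (n - Suc i)) x) x" if "x \<in> U" for x
        unfolding form_deriv_def using D Suc.prems that by (auto simp: derivatives_on_def at)
      moreover have "\<forall>x\<in>U. bounded_multilinear (n - Suc i) (D (n - Suc i) x)"
        using D by (simp add: derivatives_on_def)
      ultimately show ?case
        using Suc by auto
    qed
    from this[of n] show "forms_Cn n 0 (\<lambda>x vs. f x) U"
      using D by - (rule forms_Cn_cong[OF assms, of 0 "D 0"], auto simp: derivatives_on_def)
  next
    have tower: "\<exists>D. D 0 = A \<and> (\<forall>i\<le>n. \<forall>x\<in>U. bounded_multilinear (j + i) (D i x)) \<and>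
        (\<forall>i<n. \<forall>x\<in>U. form_deriv (j + i) (D i) (D (Suc i) x) x) \<and> (\<forall>x\<in>U. form_cont (j + n) (D n) x)"
      if "forms_Cn n j A U" for j and A :: "'a \<Rightarrow> 'a list \<Rightarrow> real"
      using that
    proof (induction n arbitrary: j A)
      case 0
      then show ?case by (intro exI[of _ "\<lambda>_. A"]) auto
    next
      case (Suc n)
      then obtain A' where A: "\<forall>x\<in>U. bounded_multilinear j (A x)" "\<forall>x\<in>U. form_deriv j A (A' x) x"
        and A': "forms_Cn n (Suc j) A' U" by auto
      obtain D where D: "D 0 = A'" "\<forall>i\<le>n. \<forall>x\<in>U. bounded_multilinear (Suc j + i) (D i x)"
        "\<forall>i<n. \<forall>x\<in>U. form_deriv (Suc j + i) (D i) (D (Suc i) x) x" "\<forall>x\<in>U. form_cont (Suc j + n) (D n) x"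
        using Suc.IH[OF A'] by blast
      define D' where "D' i = (case i of 0 \<Rightarrow> A | Suc i \<Rightarrow> D i)" for i
      have "bounded_multilinear (j + i) (D' i x)" if "i \<le> Suc n" "x \<in> U" for i x
        using that A D(2) by (cases i) (auto simp: D'_def)
      moreover have "form_deriv (j + i) (D' i) (D' (Suc i) x) x" if "i < Suc n" "x \<in> U" for i x
        using that A D(1,3) by (cases i) (auto simp: D'_def)
      ultimately show ?case
        using D(4) by (intro exI[of _ D']) (auto simp: D'_def)
    qed
    assume "forms_Cn n 0 (\<lambda>x vs. f x) U"
    from tower[OF this] obtain D where "D 0 = (\<lambda>x vs. f x)"
      "\<forall>i\<le>n. \<forall>x\<in>U. bounded_multilinear i (D i x)"
      "\<forall>i<n. \<forall>x\<in>U. form_deriv i (D i) (D (Suc i) x) x" "\<forall>x\<in>U. form_cont n (D n) x"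
      by auto
    then have "derivatives_on n f U D"
      unfolding derivatives_on_def form_deriv_def form_cont_def by (simp add: at)
    then show "Cn_on n f U"
      unfolding Cn_on_def by blast
  qed
qed

lemma mlin_norm_le_add:
  assumes "mlin_norm_le j m K" "mlin_norm_le j m' K'"
  shows "mlin_norm_le j (\<lambda>vs. m vs + m' vs) (K + K')"
  unfolding mlin_norm_le_def
  using assms by (auto simp: mlin_norm_le_def distrib_right intro!: norm_triangle_le add_mono)

lemma mlin_norm_le_cmult:
  fixes m :: "'a::real_normed_vector list \<Rightarrow> real"
  assumes "mlin_norm_le j m K"
  shows "mlin_norm_le j (\<lambda>vs. c * m vs) (\<bar>c\<bar> * K)"
  unfolding mlin_norm_le_def
  using assms by (auto simp: mlin_norm_le_def abs_mult mult.assoc intro!: mult_left_mono)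

text \<open>The increment of \<open>A\<close> at \<open>y\<close> is at most \<open>(1 + K) * norm (y - x)\<close>, where \<open>K\<close> bounds the derivative and
  the summand 1 bounds the error term.\<close>

lemma form_deriv_imp_cont:
  assumes "form_deriv j A A' x" "bounded_multilinear (Suc j) A'"
  shows "form_cont j A x"
  unfolding form_cont_def
proof (intro allI impI)
  fix e :: real assume e: "e > 0"
  obtain K where K: "K > 0" "mlin_norm_le (Suc j) A' K"
    using assms(2) by (rule bounded_multilinear_norm)
  have "\<forall>\<^sub>F y in at x. mlin_norm_le j (\<lambda>vs. A y vs - A x vs - A' ((y - x) # vs)) (1 * norm (y - x))"
    by (rule assms(1)[unfolded form_deriv_def, rule_format]) simp
  moreover have "\<forall>\<^sub>F y in at x. dist y x < e / (1 + K)"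
    unfolding eventually_at using e K by (intro exI[of _ "e / (1 + K)"]) auto
  ultimately show "\<forall>\<^sub>F y in at x. mlin_norm_le j (\<lambda>vs. A y vs - A x vs) e"
  proof eventually_elim
    case (elim y)
    have "mlin_norm_le j (\<lambda>vs. A' ((y - x) # vs)) (K * norm (y - x))"
      unfolding mlin_norm_le_def
      using K(2) by (auto simp: mlin_norm_le_def mult.assoc dest: spec[of _ "(y - x) # _"])
    from mlin_norm_le_add[OF elim(1) this]
    have "mlin_norm_le j (\<lambda>vs. A y vs - A x vs) ((1 + K) * norm (y - x))"
      by (simp add: distrib_right)
    moreover have "(1 + K) * norm (y - x) \<le> e"
      using elim(2) K by (simp add: dist_norm field_simps)
    ultimately show ?case by (rule mlin_norm_le_mono)
  qed
qed

lemma forms_Cn_Suc_imp: "forms_Cn (Suc n) j A U \<Longrightarrow> forms_Cn n j A U"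
proof (induction n arbitrary: j A)
  case 0
  then show ?case by (auto intro: form_deriv_imp_cont)
next
  case (Suc n)
  then show ?case by (metis forms_Cn.simps(2))
qed

lemma bounded_multilinear_lincomb:
  fixes m m' :: "'a::real_normed_vector list \<Rightarrow> real"
  assumes "bounded_multilinear j m" "bounded_multilinear j m'"
  shows "bounded_multilinear j (\<lambda>vs. a * m vs + b * m' vs)"
proof -
  have "linear (\<lambda>v. a * m (us @ v # vs) + b * m' (us @ v # vs))"
    if "length us + 1 + length vs = j" for us vs
    using assms that unfolding bounded_multilinear_def linear_iff
    by (simp add: algebra_simps)
  moreover have "\<exists>K. mlin_norm_le j (\<lambda>vs. a * m vs + b * m' vs) K"
    using assms mlin_norm_le_add mlin_norm_le_cmult unfolding bounded_multilinear_def by blast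
  ultimately show ?thesis
    by (auto simp: bounded_multilinear_def)
qed

lemma form_cont_lincomb:
  assumes "form_cont j A x" "form_cont j B x"
  shows "form_cont j (\<lambda>x vs. a * A x vs + b * B x vs) x"
  unfolding form_cont_def
proof (intro allI impI)
  fix e :: real assume e: "e > 0"
  define d where "d = e / (\<bar>a\<bar> + \<bar>b\<bar> + 1)"
  have d: "d > 0" "\<bar>a\<bar> * d + \<bar>b\<bar> * d \<le> e"
    using e by (auto simp: d_def field_simps add_pos_nonneg)
  have "\<forall>\<^sub>F y in at x. mlin_norm_le j (\<lambda>vs. A y vs - A x vs) d"
    "\<forall>\<^sub>F y in at x. mlin_norm_le j (\<lambda>vs. B y vs - B x vs) d"
    using assms d by (auto simp: form_cont_def)
  then show "\<forall>\<^sub>F y in at x. mlin_norm_le j (\<lambda>vs. a * A y vs + b * B y vs - (a * A x vs + b * B x vs)) e"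
  proof eventually_elim
    case (elim y)
    from mlin_norm_le_mono[OF mlin_norm_le_add[OF elim[THEN mlin_norm_le_cmult]] d(2)]
    show ?case by (rule mlin_norm_le_cong[THEN iffD1, rotated]) (simp add: algebra_simps)
  qed
qed

lemma form_deriv_lincomb:
  assumes "form_deriv j A A' x" "form_deriv j B B' x"
  shows "form_deriv j (\<lambda>x vs. a * A x vs + b * B x vs) (\<lambda>vs. a * A' vs + b * B' vs) x"
  unfolding form_deriv_def
proof (intro allI impI)
  fix e :: real assume e: "e > 0"
  define d where "d = e / (\<bar>a\<bar> + \<bar>b\<bar> + 1)"
  have d: "d > 0" "\<bar>a\<bar> * d + \<bar>b\<bar> * d \<le> e"
    using e by (auto simp: d_def field_simps add_pos_nonneg)
  have "\<forall>\<^sub>F y in at x. mlin_norm_le j (\<lambda>vs. A y vs - A x vs - A' ((y - x) # vs)) (d * norm (y - x))"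
    "\<forall>\<^sub>F y in at x. mlin_norm_le j (\<lambda>vs. B y vs - B x vs - B' ((y - x) # vs)) (d * norm (y - x))"
    using assms d by (auto simp: form_deriv_def)
  then show "\<forall>\<^sub>F y in at x. mlin_norm_le j (\<lambda>vs. a * A y vs + b * B y vs - (a * A x vs + b * B x vs) -
    (a * A' ((y - x) # vs) + b * B' ((y - x) # vs))) (e * norm (y - x))"
  proof eventually_elim
    case (elim y)
    have "\<bar>a\<bar> * (d * norm (y - x)) + \<bar>b\<bar> * (d * norm (y - x)) \<le> e * norm (y - x)"
      using mult_right_mono[OF d(2), of "norm (y - x)"] by (simp add: algebra_simps)
    from mlin_norm_le_mono[OF mlin_norm_le_add[OF elim[THEN mlin_norm_le_cmult]] this]
    show ?case by (rule mlin_norm_le_cong[THEN iffD1, rotated]) (simp add: algebra_simps)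
  qed
qed

lemma forms_Cn_lincomb:
  assumes "forms_Cn n j A U" "forms_Cn n j B U"
  shows "forms_Cn n j (\<lambda>x vs. a * A x vs + b * B x vs) U"
  using assms
proof (induction n arbitrary: j A B)
  case 0
  then show ?case by (auto intro: form_cont_lincomb bounded_multilinear_lincomb)
next
  case (Suc n)
  then obtain A' B' where "\<forall>x\<in>U. form_deriv j A (A' x) x" "forms_Cn n (Suc j) A' U"
    "\<forall>x\<in>U. form_deriv j B (B' x) x" "forms_Cn n (Suc j) B' U" by auto
  then have "\<forall>x\<in>U. form_deriv j (\<lambda>x vs. a * A x vs + b * B x vs) (\<lambda>vs. a * A' x vs + b * B' x vs) x"
    "forms_Cn n (Suc j) (\<lambda>x vs. a * A' x vs + b * B' x vs) U"
    using form_deriv_lincomb Suc.IH by blast+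
  then show ?case
    using Suc.prems by (auto intro: bounded_multilinear_lincomb)
qed

text \<open>The derivative of a product of forms contains terms in which the new argument goes to one of the two
  factors. A mask says which arguments the first factor takes, so that these terms are again
  masked products, with the mask extended by \<open>True\<close> or \<open>False\<close>, and no permutation of arguments occurs.\<close>

fun select :: "bool list \<Rightarrow> 'a list \<Rightarrow> 'a list" where
  "select (b # m) (v # vs) = (if b then v # select m vs else select m vs)"
| "select _ _ = []"

definition mask_prod :: "bool list \<Rightarrow> ('a list \<Rightarrow> real) \<Rightarrow> ('a list \<Rightarrow> real) \<Rightarrow> 'a list \<Rightarrow> real" where
  "mask_prod m p q vs = p (select m vs) * q (select (map Not m) vs)"

lemma length_select:
  "length vs = length m \<Longrightarrow> length (select m vs) = length (filter (\<lambda>b. b) m)"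
  by (induction m vs rule: list_induct2') auto

lemma length_select_Not:
  "length vs = length m \<Longrightarrow> length (select (map Not m) vs) = length (filter Not m)"
  by (induction m vs rule: list_induct2') auto

lemma select_append:
  "length us = length m \<Longrightarrow> select (m @ m') (us @ vs) = select m us @ select m' vs"
  by (induction m us rule: list_induct2') auto

text \<open>Hence operator norms are submultiplicative under \<open>mask_prod\<close>, whatever the mask.\<close>

lemma prod_list_select:
  fixes vs :: "'a::real_normed_vector list"
  assumes "length vs = length m"
  shows "prod_list (map norm (select m vs)) * prod_list (map norm (select (map Not m) vs)) =
    prod_list (map norm vs)"
  using assms by (induction m vs rule: list_induct2') (auto simp: algebra_simps)

lemma mlin_norm_le_mask_prod:
  fixes p q :: "'a::real_normed_vector list \<Rightarrow> real"
  assumes "mlin_norm_le (length (filter (\<lambda>b. b) m)) p K" "mlin_norm_le (length (filter Not m)) q L" "K \<ge> 0"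
  shows "mlin_norm_le (length m) (mask_prod m p q) (K * L)"
  unfolding mlin_norm_le_def
proof (intro allI impI)
  fix vs :: "'a list" assume l: "length vs = length m"
  let ?a = "select m vs" and ?b = "select (map Not m) vs"
  have "norm (p ?a) \<le> K * prod_list (map norm ?a)" "norm (q ?b) \<le> L * prod_list (map norm ?b)"
    using assms(1,2) length_select[OF l] length_select_Not[OF l] by (simp_all add: mlin_norm_le_def)
  then have "norm (p ?a) * norm (q ?b) \<le> (K * prod_list (map norm ?a)) * (L * prod_list (map norm ?b))"
    using assms(3) by (intro mult_mono mult_nonneg_nonneg prod_list_nonneg) auto
  also have "\<dots> = K * L * prod_list (map norm vs)"
    unfolding prod_list_select[OF l, symmetric] by simp
  finally show "norm (mask_prod m p q vs) \<le> K * L * prod_list (map norm vs)"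
    by (simp add: mask_prod_def abs_mult)
qed

lemma bounded_multilinear_mask_prod:
  fixes p q :: "'a::real_normed_vector list \<Rightarrow> real"
  assumes "bounded_multilinear (length (filter (\<lambda>b. b) m)) p" "bounded_multilinear (length (filter Not m)) q"
  shows "bounded_multilinear (length m) (mask_prod m p q)"
proof -
  have "linear (\<lambda>v. mask_prod m p q (us @ v # vs))"
    if l: "length us + 1 + length vs = length m" for us vs
  proof -
    \<comment> \<open>Multilinearity in one slot: cut the mask at this slot. Its entry there says which factor is linear in \<open>v\<close>.\<close>
    define m1 b m2 where "m1 = take (length us) m" and "b = m ! length us" and "m2 = drop (Suc (length us)) m"
    have m: "m = m1 @ b # m2" and l1: "length us = length m1" and l2: "length vs = length m2"
      using l id_take_nth_drop[of "length us" m] by (auto simp: m1_def b_def m2_def)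
    have P: "linear (\<lambda>v. p (us' @ v # vs'))" if "length us' + 1 + length vs' = length (filter (\<lambda>b. b) m)" for us' vs'
      using assms(1) that by (auto simp: bounded_multilinear_def)
    have Q: "linear (\<lambda>v. q (us' @ v # vs'))" if "length us' + 1 + length vs' = length (filter Not m)" for us' vs'
      using assms(2) that by (auto simp: bounded_multilinear_def)
    note s = select_append[OF l1] select_append[of us "map Not m1"] l1
    show ?thesis
    proof (cases b)
      case True
      have "linear (\<lambda>v. p (select m1 us @ v # select m2 vs))"
        using l1 l2 True by (intro P) (simp add: m length_select)
      then show ?thesis
        using True by (simp add: m mask_prod_def s linear_iff algebra_simps)
    next
      case False
      have "linear (\<lambda>v. q (select (map Not m1) us @ v # select (map Not m2) vs))"
        using l1 l2 False by (intro Q) (simp add: m length_select_Not)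
      then show ?thesis
        using False by (simp add: m mask_prod_def s linear_iff algebra_simps)
    qed
  qed
  moreover obtain K L where "K > 0" "mlin_norm_le (length (filter (\<lambda>b. b) m)) p K"
    "mlin_norm_le (length (filter Not m)) q L"
    using bounded_multilinear_norm[OF assms(1)] bounded_multilinear_norm[OF assms(2)] by metis
  then have "mlin_norm_le (length m) (mask_prod m p q) (K * L)"
    by (intro mlin_norm_le_mask_prod) auto
  ultimately show ?thesis
    unfolding bounded_multilinear_def by blast
qed

lemma form_cont_bound:
  assumes "bounded_multilinear j (A x)" "form_cont j A x"
  obtains K where "K > 0" "\<forall>\<^sub>F y in at x. mlin_norm_le j (A y) K"
proof -
  obtain K where K: "K > 0" "mlin_norm_le j (A x) K"
    using assms(1) by (rule bounded_multilinear_norm)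
  have "\<forall>\<^sub>F y in at x. mlin_norm_le j (\<lambda>vs. A y vs - A x vs) 1"
    using assms(2)[unfolded form_cont_def, rule_format, of 1] by simp
  then have "\<forall>\<^sub>F y in at x. mlin_norm_le j (A y) (1 + K)"
  proof eventually_elim
    case (elim y)
    from mlin_norm_le_add[OF elim K(2)] show ?case by simp
  qed
  then show ?thesis
    using K by (intro that[of "1 + K"]) auto
qed

lemma form_cont_mask_prod:
  assumes "bounded_multilinear (length (filter (\<lambda>b. b) m)) (A x)" "form_cont (length (filter (\<lambda>b. b) m)) A x"
    "bounded_multilinear (length (filter Not m)) (B x)" "form_cont (length (filter Not m)) B x"
  shows "form_cont (length m) (\<lambda>x. mask_prod m (A x) (B x)) x"
  unfolding form_cont_def
proof (intro allI impI)
  fix e :: real assume e: "e > 0"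
  obtain K where K: "K > 0" "mlin_norm_le (length (filter (\<lambda>b. b) m)) (A x) K"
    using assms(1) by (rule bounded_multilinear_norm)
  obtain L where L: "L > 0" "\<forall>\<^sub>F y in at x. mlin_norm_le (length (filter Not m)) (B y) L"
    using assms(3,4) by (rule form_cont_bound)
  define d where "d = e / (K + L)"
  have "d * (K + L) = e"
    using K L by (simp add: d_def)
  moreover have "d > 0"
    using e K L by (simp add: d_def)
  ultimately have d: "d > 0" "d * L + K * d \<le> e"
    by (simp_all add: algebra_simps)
  have "\<forall>\<^sub>F y in at x. mlin_norm_le (length (filter (\<lambda>b. b) m)) (\<lambda>vs. A y vs - A x vs) d"
    "\<forall>\<^sub>F y in at x. mlin_norm_le (length (filter Not m)) (\<lambda>vs. B y vs - B x vs) d"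
    using assms d by (auto simp: form_cont_def)
  with L(2) show "\<forall>\<^sub>F y in at x. mlin_norm_le (length m)
      (\<lambda>vs. mask_prod m (A y) (B y) vs - mask_prod m (A x) (B x) vs) e"
  proof eventually_elim
    case (elim y)
    have "mlin_norm_le (length m) (mask_prod m (\<lambda>vs. A y vs - A x vs) (B y)) (d * L)"
      "mlin_norm_le (length m) (mask_prod m (A x) (\<lambda>vs. B y vs - B x vs)) (K * d)"
      using elim K d by (auto intro: mlin_norm_le_mask_prod)
    from mlin_norm_le_mono[OF mlin_norm_le_add[OF this] d(2)]
    show ?case by (simp add: mask_prod_def algebra_simps)
  qed
qed

text \<open>The product rule. With \<open>h = y - x\<close> the error is the sum of
  \<open>(A y - A x - A' h) * B y\<close>, \<open>A' h * (B y - B x)\<close> and \<open>A x * (B y - B x - B' h)\<close>, each of which is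
  \<open>o (norm h)\<close>.\<close>

lemma form_deriv_mask_prod:
  assumes "bounded_multilinear (length (filter (\<lambda>b. b) m)) (A x)"
    "bounded_multilinear (Suc (length (filter (\<lambda>b. b) m))) A'" "form_deriv (length (filter (\<lambda>b. b) m)) A A' x"
    "bounded_multilinear (length (filter Not m)) (B x)"
    "bounded_multilinear (Suc (length (filter Not m))) B'" "form_deriv (length (filter Not m)) B B' x"
  shows "form_deriv (length m) (\<lambda>x. mask_prod m (A x) (B x))
    (\<lambda>vs. mask_prod (True # m) A' (B x) vs + mask_prod (False # m) (A x) B' vs) x"
  unfolding form_deriv_def
proof (intro allI impI)
  let ?i = "length (filter (\<lambda>b. b) m)" and ?k = "length (filter Not m)"
  fix e :: real assume e: "e > 0"
  have cB: "form_cont ?k B x"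
    using assms by (auto intro: form_deriv_imp_cont)
  obtain K where K: "K > 0" "mlin_norm_le ?i (A x) K"
    using assms(1) by (rule bounded_multilinear_norm)
  obtain K' where K': "K' > 0" "mlin_norm_le (Suc ?i) A' K'"
    using assms(2) by (rule bounded_multilinear_norm)
  obtain L where L: "L > 0" "\<forall>\<^sub>F y in at x. mlin_norm_le ?k (B y) L"
    using assms(4) cB by (rule form_cont_bound)
  define d where "d = e / (K + K' + L)"
  have "d * (K + K' + L) = e"
    using K K' L by (simp add: d_def)
  moreover have "d > 0"
    using e K K' L by (simp add: d_def)
  ultimately have d: "d > 0" "d * L + K' * d + K * d = e"
    by (simp_all add: algebra_simps)
  have "\<forall>\<^sub>F y in at x. mlin_norm_le ?i (\<lambda>vs. A y vs - A x vs - A' ((y - x) # vs)) (d * norm (y - x))"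
    "\<forall>\<^sub>F y in at x. mlin_norm_le ?k (\<lambda>vs. B y vs - B x vs - B' ((y - x) # vs)) (d * norm (y - x))"
    using assms d by (auto simp: form_deriv_def)
  moreover have "\<forall>\<^sub>F y in at x. mlin_norm_le ?k (\<lambda>vs. B y vs - B x vs) d"
    using cB d by (auto simp: form_cont_def)
  ultimately show "\<forall>\<^sub>F y in at x. mlin_norm_le (length m)
      (\<lambda>vs. mask_prod m (A y) (B y) vs - mask_prod m (A x) (B x) vs -
        (mask_prod (True # m) A' (B x) ((y - x) # vs) + mask_prod (False # m) (A x) B' ((y - x) # vs)))
      (e * norm (y - x))"
    using L(2)
  proof eventually_elim
    case (elim y)
    let ?h = "y - x"
    have "mlin_norm_le ?i (\<lambda>vs. A' (?h # vs)) (K' * norm ?h)"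
      unfolding mlin_norm_le_def
      using K'(2) by (auto simp: mlin_norm_le_def mult.assoc dest: spec[of _ "?h # _"])
    then have "mlin_norm_le (length m) (mask_prod m (\<lambda>vs. A y vs - A x vs - A' (?h # vs)) (B y)) (d * norm ?h * L)"
      "mlin_norm_le (length m) (mask_prod m (\<lambda>vs. A' (?h # vs)) (\<lambda>vs. B y vs - B x vs)) (K' * norm ?h * d)"
      "mlin_norm_le (length m) (mask_prod m (A x) (\<lambda>vs. B y vs - B x vs - B' (?h # vs))) (K * (d * norm ?h))"
      using elim K K' d by (auto intro!: mlin_norm_le_mask_prod)
    from mlin_norm_le_add[OF mlin_norm_le_add[OF this(1,2)] this(3)]
    have "mlin_norm_le (length m) (\<lambda>vs. mask_prod m (\<lambda>vs. A y vs - A x vs - A' (?h # vs)) (B y) vs +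
       mask_prod m (\<lambda>vs. A' (?h # vs)) (\<lambda>vs. B y vs - B x vs) vs +
       mask_prod m (A x) (\<lambda>vs. B y vs - B x vs - B' (?h # vs)) vs) (e * norm ?h)"
      unfolding d(2)[symmetric] by (simp add: algebra_simps)
    then show ?case by (simp add: mask_prod_def algebra_simps)
  qed
qed

lemma forms_Cn_mask_prod:
  assumes "forms_Cn n (length (filter (\<lambda>b. b) m)) A U" "forms_Cn n (length (filter Not m)) B U"
  shows "forms_Cn n (length m) (\<lambda>x. mask_prod m (A x) (B x)) U"
  using assms
proof (induction n arbitrary: m A B)
  case 0
  then show ?case by (auto intro: bounded_multilinear_mask_prod form_cont_mask_prod)
next
  case (Suc n)
  let ?i = "length (filter (\<lambda>b. b) m)" and ?k = "length (filter Not m)"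
  obtain A' B' where A': "\<forall>x\<in>U. form_deriv ?i A (A' x) x" "forms_Cn n (Suc ?i) A' U"
    and B': "\<forall>x\<in>U. form_deriv ?k B (B' x) x" "forms_Cn n (Suc ?k) B' U" 
    using Suc.prems by auto
  have AB: "forms_Cn n ?i A U" "forms_Cn n ?k B U"
    using Suc.prems by (blast intro: forms_Cn_Suc_imp)+
  have "forms_Cn n (length (True # m)) (\<lambda>x. mask_prod (True # m) (A' x) (B x)) U"
    "forms_Cn n (length (False # m)) (\<lambda>x. mask_prod (False # m) (A x) (B' x)) U"
    by (rule Suc.IH; use AB A' B' in simp)+
  from forms_Cn_lincomb[OF this[simplified], of 1 1]
  have "forms_Cn n (Suc (length m))
      (\<lambda>x vs. mask_prod (True # m) (A' x) (B x) vs + mask_prod (False # m) (A x) (B' x) vs) U"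
    by simp
  moreover have "form_deriv (length m) (\<lambda>x. mask_prod m (A x) (B x))
      (\<lambda>vs. mask_prod (True # m) (A' x) (B x) vs + mask_prod (False # m) (A x) (B' x) vs) x" if "x \<in> U" for x
    using that A' B' AB by (intro form_deriv_mask_prod) (auto dest: forms_Cn_multilinear)
  moreover have "\<forall>x\<in>U. bounded_multilinear (length m) (mask_prod m (A x) (B x))"
    using AB by (auto intro!: bounded_multilinear_mask_prod dest: forms_Cn_multilinear)
  ultimately show ?case
    unfolding forms_Cn.simps
    by (intro conjI exI[of _ "\<lambda>x vs. mask_prod (True # m) (A' x) (B x) vs + mask_prod (False # m) (A x) (B' x) vs"])
      simp_all
qed

text \<open>Freezing the remaining arguments \<open>vs\<close> gives an ordinary derivative. This yields uniqueness of
  derivatives of forms and access to the chain rule.\<close>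

lemma form_deriv_imp_has_derivative:
  assumes "bounded_multilinear (Suc (length vs)) A'" "form_deriv (length vs) A A' x"
  shows "((\<lambda>y. A y vs) has_derivative (\<lambda>h. A' (h # vs))) (at x)"
proof -
  let ?P = "prod_list (map norm vs)"
  have P: "?P \<ge> 0" by (intro prod_list_nonneg) auto
  obtain K where K: "mlin_norm_le (Suc (length vs)) A' K"
    using assms(1) by (rule bounded_multilinear_norm)
  have "linear (\<lambda>h. A' ([] @ h # vs))"
    using assms(1) unfolding bounded_multilinear_def by (metis add.left_neutral list.size(3) plus_1_eq_Suc)
  moreover have "norm (A' (h # vs)) \<le> norm h * (K * ?P)" for h
    using K[unfolded mlin_norm_le_def, rule_format, of "h # vs"] by (simp add: mult_ac)
  ultimately have bl: "bounded_linear (\<lambda>h. A' (h # vs))"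
    by (intro bounded_linear_intro[where K = "K * ?P"]) (auto simp: linear_iff)
  show ?thesis
    unfolding has_derivative_iff_mlin[OF bl UNIV_I open_UNIV]
  proof (intro allI impI)
    fix e :: real assume e: "e > 0"
    define d where "d = e / (?P + 1)"
    have "d > 0" "d * ?P \<le> e"
      using e P by (auto simp: d_def field_simps add_nonneg_pos)
    then have "\<forall>\<^sub>F y in at x. mlin_norm_le (length vs) (\<lambda>vs. A y vs - A x vs - A' ((y - x) # vs)) (d * norm (y - x))"
      using assms(2) by (simp add: form_deriv_def)
    then show "\<forall>\<^sub>F y in at x. norm (A y vs - A x vs - A' ((y - x) # vs)) \<le> e * norm (y - x)"
    proof eventually_elim
      case (elim y)
      have "norm (A y vs - A x vs - A' ((y - x) # vs)) \<le> d * norm (y - x) * ?P"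
        using elim[unfolded mlin_norm_le_def, rule_format, of vs] by simp
      also have "\<dots> = d * ?P * norm (y - x)" by simp
      also have "\<dots> \<le> e * norm (y - x)"
        using \<open>d * ?P \<le> e\<close> by (rule mult_right_mono) simp
      finally show ?case .
    qed
  qed
qed

lemma form_deriv_0I:
  assumes "(f has_derivative (\<lambda>h. A' [h])) (at x)"
  shows "form_deriv 0 (\<lambda>x vs. f x) A' x"
  using assms has_derivative_iff_mlin[OF has_derivative_bounded_linear[OF assms] UNIV_I open_UNIV, of f]
  by (simp add: form_deriv_def mlin_norm_le_def)

text \<open>Smoothness in one variable, as membership in a class of functions closed under differentiation:
  to verify it no derivatives of higher order have to be computed.\<close>

definition smooth_real :: "(real \<Rightarrow> real) \<Rightarrow> bool" where
  "smooth_real h \<longleftrightarrow> (\<exists>H. h \<in> H \<and> (\<forall>f\<in>H. \<exists>f'\<in>H. \<forall>t. (f has_real_derivative f' t) (at t)))"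

lemma smooth_real_deriv:
  assumes "smooth_real h"
  obtains h' where "smooth_real h'" "\<And>t. (h has_real_derivative h' t) (at t)"
  using assms unfolding smooth_real_def by metis

text \<open>The derivative of \<open>h \<circ> g\<close> is the product of \<open>h' \<circ> g\<close> and \<open>g'\<close>, and \<open>h'\<close> is again smooth. So the
  induction reduces to products and no formula for higher derivatives of a composition occurs.\<close>

lemma forms_Cn_compose:
  fixes g :: "'a::real_normed_vector \<Rightarrow> real"
  assumes "smooth_real h" "forms_Cn n 0 (\<lambda>x vs. g x) U"
  shows "forms_Cn n 0 (\<lambda>x vs. h (g x)) U"
  using assms
proof (induction n arbitrary: h)
  case 0
  obtain h' where h': "\<And>t. (h has_real_derivative h' t) (at t)"
    using 0(1) by (rule smooth_real_deriv) blast
  have c: "isCont h t" for t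
    using h' DERIV_isCont by blast
  have iff: "form_cont 0 (\<lambda>x vs. f x) x \<longleftrightarrow> isCont f x" for f :: "'a \<Rightarrow> real" and x
  proof -
    have "isCont f x \<longleftrightarrow> (\<forall>e>0. \<forall>\<^sub>F y in at x. \<bar>f y - f x\<bar> < e)"
      by (simp add: isCont_def tendsto_iff dist_real_def)
    also have "\<dots> \<longleftrightarrow> (\<forall>e>0. \<forall>\<^sub>F y in at x. \<bar>f y - f x\<bar> \<le> e)"
    proof (intro iffI allI impI)
      fix e :: real assume *: "\<forall>e>0. \<forall>\<^sub>F y in at x. \<bar>f y - f x\<bar> \<le> e" "e > 0"
      then have "\<forall>\<^sub>F y in at x. \<bar>f y - f x\<bar> \<le> e / 2"
        using half_gt_zero by blast
      then show "\<forall>\<^sub>F y in at x. \<bar>f y - f x\<bar> < e"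
        by eventually_elim (use *(2) in linarith)
    qed (auto elim!: eventually_mono allE)
    finally show ?thesis
      by (simp add: form_cont_def mlin_norm_le_def)
  qed
  have "isCont (\<lambda>x. h (g x)) x" if "x \<in> U" for x
    using 0(2) that c by (intro isCont_o2[of x g h]) (auto simp: iff)
  moreover have "bounded_multilinear 0 (\<lambda>vs :: 'a list. h (g x))" for x
    by (auto simp: bounded_multilinear_def mlin_norm_le_def)
  ultimately show ?case
    by (simp add: iff)
next
  case (Suc n)
  obtain h' where h': "smooth_real h'" "\<And>t. (h has_real_derivative h' t) (at t)"
    using Suc.prems(1) by (rule smooth_real_deriv) blast
  obtain G where G: "\<forall>x\<in>U. form_deriv 0 (\<lambda>x vs. g x) (G x) x" "forms_Cn n (Suc 0) G U"
    using Suc.prems(2) by auto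
  have "forms_Cn n 0 (\<lambda>x vs. h' (g x)) U"
    using Suc.IH h'(1) forms_Cn_Suc_imp[OF Suc.prems(2)] by blast
  then have "forms_Cn n (length [False]) (\<lambda>x. mask_prod [False] (\<lambda>vs. h' (g x)) (G x)) U"
    using G(2) by (intro forms_Cn_mask_prod) auto
  moreover have "form_deriv 0 (\<lambda>x vs. h (g x)) (mask_prod [False] (\<lambda>vs. h' (g x)) (G x)) x" if "x \<in> U" for x
  proof (rule form_deriv_0I)
    have "(g has_derivative (\<lambda>v. G x [v])) (at x)"
      using form_deriv_imp_has_derivative[of "[]" "G x" "\<lambda>x vs. g x" x] G that
      by (auto dest: forms_Cn_multilinear)
    from has_derivative_compose[OF this h'(2)[unfolded has_field_derivative_def]]
    show "((\<lambda>x. h (g x)) has_derivative (\<lambda>v. mask_prod [False] (\<lambda>vs. h' (g x)) (G x) [v])) (at x)"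
      by (simp add: mask_prod_def)
  qed
  moreover have "bounded_multilinear 0 (\<lambda>vs :: 'a list. h (g x))" for x
    by (auto simp: bounded_multilinear_def mlin_norm_le_def)
  ultimately show ?case
    by (auto intro!: exI[of _ "\<lambda>x. mask_prod [False] (\<lambda>vs. h' (g x)) (G x)"])
qed

lemma forms_Cn_subset: "forms_Cn n j A U \<Longrightarrow> V \<subseteq> U \<Longrightarrow> forms_Cn n j A V"
proof (induction n arbitrary: j A)
  case (Suc n)
  then show ?case unfolding forms_Cn.simps by (meson subset_iff)
qed auto

text \<open>The local derivatives agree where their domains overlap, by uniqueness on open sets. Therefore
  \<open>A' x x\<close>, the value at \<open>x\<close> of the derivative chosen around \<open>x\<close>, is near each point equal to
  one of the chosen derivatives.\<close>

lemma forms_Cn_local: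
  assumes "open U" "\<And>x. x \<in> U \<Longrightarrow> \<exists>V. open V \<and> x \<in> V \<and> forms_Cn n j A V"
  shows "forms_Cn n j A U"
  using assms(2)
proof (induction n arbitrary: j A)
  case 0
  then show ?case by auto
next
  case (Suc n)
  have "\<forall>x\<in>U. \<exists>V A'. open V \<and> x \<in> V \<and> (\<forall>y\<in>V. form_deriv j A (A' y) y) \<and> forms_Cn n (Suc j) A' V"
    using Suc.prems unfolding forms_Cn.simps by blast
  then obtain V A' where V: "\<And>x. x \<in> U \<Longrightarrow> open (V x)" "\<And>x. x \<in> U \<Longrightarrow> x \<in> V x"
    and A': "\<And>x y. x \<in> U \<Longrightarrow> y \<in> V x \<Longrightarrow> form_deriv j A (A' x y) y"
      "\<And>x. x \<in> U \<Longrightarrow> forms_Cn n (Suc j) (A' x) (V x)"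
    by metis
  have "forms_Cn n (Suc j) (\<lambda>x. A' x x) U"
  proof (rule Suc.IH)
    fix x assume x: "x \<in> U"
    have "A' x y vs = A' y y vs" if y: "y \<in> V x \<inter> U" and l: "length vs = Suc j" for y vs
    proof -
      obtain h ws where vs: "vs = h # ws" "length ws = j"
        using l by (cases vs) auto
      have "bounded_multilinear (Suc j) (A' x y)" "bounded_multilinear (Suc j) (A' y y)"
        using A'(2)[of x] A'(2)[of y] V x y by (auto dest: forms_Cn_multilinear)
      moreover have "form_deriv j A (A' x y) y" "form_deriv j A (A' y y) y"
        using A'(1) x y V by auto
      ultimately have "((\<lambda>y. A y ws) has_derivative (\<lambda>h. A' x y (h # ws))) (at y)"
        "((\<lambda>y. A y ws) has_derivative (\<lambda>h. A' y y (h # ws))) (at y)"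
        using form_deriv_imp_has_derivative[of ws] vs(2) by auto
      from has_derivative_unique[OF this] show ?thesis
        unfolding vs(1) by metis
    qed
    moreover have "forms_Cn n (Suc j) (A' x) (V x \<inter> U)"
      using A'(2)[OF x] by (rule forms_Cn_subset) simp
    ultimately have "forms_Cn n (Suc j) (\<lambda>x. A' x x) (V x \<inter> U)"
      using V(1)[OF x] assms(1) forms_Cn_cong[of "V x \<inter> U" "Suc j" "A' x" "\<lambda>x. A' x x"] by blast
    then show "\<exists>V. open V \<and> x \<in> V \<and> forms_Cn n (Suc j) (\<lambda>x. A' x x) V"
      using V x assms(1) by (intro exI[of _ "V x \<inter> U"]) auto
  qed
  moreover have "\<forall>x\<in>U. form_deriv j A (A' x x) x"
    using A'(1) V(2) by blast
  moreover have "\<forall>x\<in>U. bounded_multilinear j (A x)"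
    using Suc.prems forms_Cn_multilinear by blast
  ultimately show ?case by (auto intro!: exI[of _ "\<lambda>x. A' x x"])
qed

section \<open>Real functions of class C^k\<close>

lemma Ck_on_iff_forms:
  fixes f :: "'a::real_normed_vector \<Rightarrow> real"
  assumes "open U"
  shows "Ck_on k f U \<longleftrightarrow> (\<forall>n. k = enat n \<or> k = \<infinity> \<longrightarrow> forms_Cn n 0 (\<lambda>x vs. f x) U)"
  using Cn_on_iff_forms[OF assms] by (cases k) (auto simp: Ck_on_def)

lemma Ck_on_lincomb:
  fixes f g :: "'a::real_normed_vector \<Rightarrow> real"
  assumes "open U" "Ck_on k f U" "Ck_on k g U"
  shows "Ck_on k (\<lambda>x. a * f x + b * g x) U"
  using assms by (simp add: Ck_on_iff_forms forms_Cn_lincomb)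

lemma Ck_on_mult:
  fixes f g :: "'a::real_normed_vector \<Rightarrow> real"
  assumes "open U" "Ck_on k f U" "Ck_on k g U"
  shows "Ck_on k (\<lambda>x. f x * g x) U"
proof -
  have "forms_Cn n 0 (\<lambda>x vs. f x * g x) U"
    if "forms_Cn n 0 (\<lambda>x vs. f x) U" "forms_Cn n 0 (\<lambda>x vs. g x) U" for n
    using forms_Cn_mask_prod[of n "[]" "\<lambda>x vs. f x" U "\<lambda>x vs. g x"] that
    by (simp add: mask_prod_def[abs_def])
  then show ?thesis
    using assms by (simp add: Ck_on_iff_forms)
qed

lemma Ck_on_compose:
  fixes g :: "'a::real_normed_vector \<Rightarrow> real"
  assumes "open U" "smooth_real h" "Ck_on k g U"
  shows "Ck_on k (\<lambda>x. h (g x)) U"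
  using assms by (simp add: Ck_on_iff_forms forms_Cn_compose)

lemma Ck_on_subset:
  fixes f :: "'a::real_normed_vector \<Rightarrow> real"
  assumes "open U" "open V" "V \<subseteq> U" "Ck_on k f U"
  shows "Ck_on k f V"
  using assms forms_Cn_subset[OF _ assms(3)] by (auto simp: Ck_on_iff_forms)

lemma Ck_on_cong:
  fixes f :: "'a::real_normed_vector \<Rightarrow> real"
  assumes "open U" "\<And>x. x \<in> U \<Longrightarrow> f x = g x" "Ck_on k f U"
  shows "Ck_on k g U"
proof -
  have "forms_Cn n 0 (\<lambda>x vs. g x) U" if "forms_Cn n 0 (\<lambda>x vs. f x) U" for n
    by (rule forms_Cn_cong[OF assms(1) _ that]) (simp add: assms(2))
  then show ?thesis
    using assms by (simp add: Ck_on_iff_forms)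
qed

lemma Ck_on_local:
  fixes f :: "'a::real_normed_vector \<Rightarrow> real"
  assumes "open U" "\<And>x. x \<in> U \<Longrightarrow> \<exists>V. open V \<and> x \<in> V \<and> Ck_on k f V"
  shows "Ck_on k f U"
  unfolding Ck_on_iff_forms[OF assms(1)]
proof (intro allI impI forms_Cn_local[OF assms(1)])
  fix n x assume n: "k = enat n \<or> k = \<infinity>" and "x \<in> U"
  then obtain V where "open V" "x \<in> V" "Ck_on k f V"
    using assms(2) by blast
  then show "\<exists>V. open V \<and> x \<in> V \<and> forms_Cn n 0 (\<lambda>x vs. f x) V"
    using n Ck_on_iff_forms by blast
qed

section \<open>A smooth step on the real line\<close>

lemma smooth_real_affine:
  assumes "smooth_real h"
  shows "smooth_real (\<lambda>t. c * h (a + b * t))"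
proof -
  obtain H where H: "h \<in> H" "\<And>f. f \<in> H \<Longrightarrow> \<exists>f'\<in>H. \<forall>t. (f has_real_derivative f' t) (at t)"
    using assms unfolding smooth_real_def by blast
  show ?thesis
    unfolding smooth_real_def
  proof (intro exI[of _ "{\<lambda>t. c * f (a + b * t) | c f. f \<in> H}"] conjI ballI)
    show "(\<lambda>t. c * h (a + b * t)) \<in> {\<lambda>t. c * f (a + b * t) | c f. f \<in> H}"
      using H(1) by blast
    fix F assume "F \<in> {\<lambda>t. c * f (a + b * t) | c f. f \<in> H}"
    then obtain c f where F: "F = (\<lambda>t. c * f (a + b * t))" "f \<in> H" by blast
    obtain f' where f': "f' \<in> H" "\<And>t. (f has_real_derivative f' t) (at t)"
      using H(2)[OF F(2)] by blast
    have "(F has_real_derivative (c * b) * f' (a + b * t)) (at t)" for t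
      unfolding F(1) by (auto intro!: derivative_eq_intros DERIV_chain2[OF f'(2)])
    then show "\<exists>F'\<in>{\<lambda>t. c * f (a + b * t) | c f. f \<in> H}. \<forall>t. (F has_real_derivative F' t) (at t)"
      using f'(1) by (intro bexI[of _ "\<lambda>t. (c * b) * f' (a + b * t)"]) auto
  qed
qed

text \<open>The derivatives of \<open>exp (- 1 / t)\<close>, extended by 0 to \<open>t \<le> 0\<close>, all have this form.\<close>

definition flat :: "real poly \<Rightarrow> real \<Rightarrow> real" where
  "flat P t = (if t > 0 then poly P (inverse t) * exp (- inverse t) else 0)"

lemma poly_times_exp_tendsto_0: "((\<lambda>s. poly P s * exp (- s)) \<longlongrightarrow> (0::real)) at_top"
proof -
  have "((\<lambda>s. \<Sum>i\<le>degree P. coeff P i * (s ^ i / exp s)) \<longlongrightarrow> (\<Sum>i\<le>degree P. coeff P i * 0)) at_top"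
    by (intro tendsto_intros tendsto_power_div_exp_0)
  moreover have "poly P s * exp (- s) = (\<Sum>i\<le>degree P. coeff P i * (s ^ i / exp s))" for s :: real
    by (simp add: poly_altdef sum_distrib_right exp_minus divide_inverse mult.assoc)
  ultimately show ?thesis by simp
qed

lemma flat_has_derivative:
  "(flat P has_real_derivative flat (monom 1 2 * (P - pderiv P)) t) (at t)"
proof -
  consider "t < 0" | "t = 0" | "t > 0" by linarith
  then show ?thesis
  proof cases
    case 1
    have "((\<lambda>_. 0) has_real_derivative 0) (at t)" by simp
    then have "(flat P has_real_derivative 0) (at t)"
      by (rule has_field_derivative_transform_within_open[of _ _ _ "{..<0}"]) (use 1 in \<open>auto simp: flat_def\<close>)
    then show ?thesis using 1 by (simp add: flat_def)
  next
    case 2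
    have "((\<lambda>h. flat P h / h) \<longlongrightarrow> 0) (at_left 0)"
      by (rule tendsto_eventually) (auto simp: flat_def eventually_at_filter)
    moreover have "((\<lambda>h. flat P h / h) \<longlongrightarrow> 0) (at_right 0)"
      unfolding filterlim_at_right_to_top
    proof (rule Lim_transform_eventually[OF poly_times_exp_tendsto_0[of "pCons 0 P"]])
      show "\<forall>\<^sub>F s in at_top. poly (pCons 0 P) s * exp (- s) = flat P (inverse s) / inverse s"
        using eventually_gt_at_top[of 0] by eventually_elim (simp add: flat_def field_simps)
    qed
    ultimately have "((\<lambda>h. flat P h / h) \<longlongrightarrow> 0) (at 0)"
      by (simp add: filterlim_split_at)
    then show ?thesis
      using 2 by (simp add: DERIV_def flat_def[of _ 0])
  next
    case 3
    have "((\<lambda>t. poly P (inverse t) * exp (- inverse t)) has_real_derivative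
        flat (monom 1 2 * (P - pderiv P)) t) (at t)"
      using 3 by (auto intro!: derivative_eq_intros DERIV_chain2[OF poly_DERIV]
          simp: flat_def poly_monom field_simps power2_eq_square)
    then show ?thesis
      by (rule has_field_derivative_transform_within_open[of _ _ _ "{0<..}"]) (use 3 in \<open>auto simp: flat_def\<close>)
  qed
qed

lemma smooth_real_flat: "smooth_real (flat P)"
  unfolding smooth_real_def
  by (rule exI[of _ "range flat"]) (use flat_has_derivative in blast)

lemma flat_1: "flat 1 t = (if t > 0 then exp (- inverse t) else 0)"
  by (simp add: flat_def)

text \<open>The derivative at \<open>t = 1 / s > 0\<close> is \<open>s\<^sup>2 * exp (- s)\<close>, and \<open>s\<^sup>2 \<le> 2 * exp s\<close>.\<close>

lemma flat_1_lipschitz: "2-lipschitz_on UNIV (flat 1)"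
proof (rule bounded_derivative_imp_lipschitz)
  fix t :: real
  show "(flat 1 has_derivative (*) (flat (monom 1 2) t)) (at t within UNIV)"
    using flat_has_derivative[of 1 t] by (simp add: has_field_derivative_def)
  have "\<bar>flat (monom 1 2) t\<bar> \<le> 2"
  proof (cases "t > 0")
    case True
    define s where "s = inverse t"
    have s: "s > 0" using True by (simp add: s_def)
    have "1 + s + s\<^sup>2 / 2 \<le> exp s"
      using s by (intro exp_lower_Taylor_quadratic) simp
    then have "s\<^sup>2 \<le> 2 * exp s" using s by simp
    then have "s\<^sup>2 * exp (- s) \<le> 2"
      by (simp add: exp_minus field_simps)
    then show ?thesis
      using True by (simp add: flat_def s_def poly_monom)
  qed (simp add: flat_def)
  then show "onorm ((*) (flat (monom 1 2) t)) \<le> 2"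
    by (intro onorm_le) (simp add: abs_mult mult_right_mono)
qed auto

text \<open>With \<open>E = flat 1\<close>, the function \<open>exp 1 * E (1 - exp 1 * E t)\<close> is a smooth step: \<open>E\<close> vanishes on
  \<open>t \<le> 0\<close>, where the value is \<open>exp 1 * E 1 = 1\<close>, and \<open>exp 1 * E t \<ge> 1\<close> for \<open>t \<ge> 1\<close>, where the outer
  \<open>E\<close> vanishes. Being a composition it needs no quotients of smooth functions.\<close>

lemma smooth_step_exists:
  obtains h1 h2 :: "real \<Rightarrow> real" and M
  where "smooth_real h1" "smooth_real h2" "M-lipschitz_on UNIV (\<lambda>t. h2 (h1 t))"
    "\<And>t. 0 \<le> h2 (h1 t)" "\<And>t. h2 (h1 t) \<le> 1"
    "\<And>t. t \<le> 0 \<Longrightarrow> h2 (h1 t) = 1" "\<And>t. t \<ge> 1 \<Longrightarrow> h2 (h1 t) = 0"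
proof -
  let ?E = "flat 1"
  define h2 where "h2 s = exp 1 * ?E (1 + (- exp 1) * s)" for s :: real
  have E0: "?E t \<ge> 0" for t by (simp add: flat_1)
  have E1: "?E 1 = exp (- 1)" by (simp add: flat_1)
  have mono: "?E s \<le> ?E t" if "s \<le> t" for s t
    using that by (auto simp: flat_1 le_imp_inverse_le)
  have "smooth_real h2"
    unfolding h2_def by (intro smooth_real_affine smooth_real_flat)
  moreover have "(exp 1 * (2 * (\<bar>- exp 1\<bar> * 2)))-lipschitz_on UNIV (\<lambda>t. h2 (?E t))"
  proof (rule lipschitz_onI)
    fix s t :: real
    have l: "\<bar>?E x - ?E y\<bar> \<le> 2 * \<bar>x - y\<bar>" for x y
      using lipschitz_onD[OF flat_1_lipschitz, of x y] by (simp add: dist_real_def)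
    have "\<bar>h2 (?E s) - h2 (?E t)\<bar> = exp 1 * \<bar>?E (1 + (- exp 1) * ?E s) - ?E (1 + (- exp 1) * ?E t)\<bar>"
      unfolding h2_def right_diff_distrib[symmetric] abs_mult by simp
    also have "\<dots> \<le> exp 1 * (2 * \<bar>(1 + (- exp 1) * ?E s) - (1 + (- exp 1) * ?E t)\<bar>)"
      by (intro mult_left_mono l) simp
    also have "(1 + (- exp 1) * ?E s) - (1 + (- exp 1) * ?E t) = (- exp 1) * (?E s - ?E t)"
      by (simp add: algebra_simps)
    also have "exp 1 * (2 * \<bar>(- exp 1) * (?E s - ?E t)\<bar>) \<le> exp 1 * (2 * (\<bar>- exp 1\<bar> * (2 * \<bar>s - t\<bar>)))"
      unfolding abs_mult[of "- exp 1"] by (intro mult_left_mono l) auto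
    finally show "dist (h2 (?E s)) (h2 (?E t)) \<le> exp 1 * (2 * (\<bar>- exp 1\<bar> * 2)) * dist s t"
      by (simp add: dist_real_def mult_ac)
  qed simp
  moreover have "h2 (?E t) \<ge> 0" for t
    by (simp add: h2_def E0)
  moreover have "h2 (?E t) \<le> 1" for t
  proof -
    have "?E (1 + (- exp 1) * ?E t) \<le> exp (- 1)"
      unfolding E1[symmetric] by (intro mono) (simp add: E0)
    then show ?thesis
      by (simp add: h2_def exp_minus field_simps)
  qed
  moreover have "h2 (?E t) = 1" if "t \<le> 0" for t
    using that E1 by (simp add: h2_def flat_1 exp_minus)
  moreover have "h2 (?E t) = 0" if "t \<ge> 1" for t
  proof -
    have "exp (- 1) \<le> ?E t"
      unfolding E1[symmetric] using that by (rule mono)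
    then have "1 + (- exp 1) * ?E t \<le> 0"
      by (simp add: exp_minus field_simps)
    then show ?thesis by (simp add: h2_def flat_1)
  qed
  ultimately show ?thesis
    using that smooth_real_flat by blast
qed

section \<open>Approximable Lipschitz functions and smooth cutoffs\<close>

text \<open>The form in which the hypothesis on the space is used: only balls around the origin, and bounds
  on the Lipschitz constants instead of the constants.\<close>

definition lip_approximable :: "enat \<Rightarrow> 'a::real_normed_vector itself \<Rightarrow> bool" where
  "lip_approximable k _ \<longleftrightarrow> (\<forall>(f :: 'a \<Rightarrow> real) \<eta>. (\<exists>L. L-lipschitz_on UNIV f) \<longrightarrow> \<eta> > 0 \<longrightarrow>
     (\<exists>g. Ck_on k g UNIV \<and> (\<forall>x. \<bar>f x - g x\<bar> \<le> \<eta>) \<and>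
       (\<forall>r>0. \<forall>M. M-lipschitz_on (cball 0 (r + \<eta>)) f \<longrightarrow> (M + \<eta>)-lipschitz_on (cball 0 r) g)))"

text \<open>The infimum that defines \<open>Lip\<close> is itself a Lipschitz constant: for each pair of points, let the
  admissible constants tend to it. As they are positive, a constant \<open>L = 0\<close> is reached only as a limit.\<close>

lemma Lip_le_ereal_iff:
  assumes "L \<ge> 0"
  shows "Lip f S \<le> ereal L \<longleftrightarrow> L-lipschitz_on S f"
proof
  assume le: "Lip f S \<le> ereal L"
  show "L-lipschitz_on S f"
  proof (rule lipschitz_onI[OF _ assms])
    fix x y assume xy: "x \<in> S" "y \<in> S"
    show "dist (f x) (f y) \<le> L * dist x y"
    proof (rule field_le_epsilon)
      fix e :: real assume e: "e > 0"
      define d where "d = e / (dist x y + 1)"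
      have p: "dist x y + 1 > 0"
        by (simp add: add_nonneg_pos)
      then have d: "d > 0" "d * (dist x y + 1) = e"
        using e by (simp_all add: d_def)
      have "Lip f S < ereal (L + d)"
        using le d by (simp add: le_less_trans)
      then obtain L' where L': "L' < L + d" "\<bar>f x - f y\<bar> \<le> L' * dist x y"
        using xy by (auto simp: Lip_def Inf_less_iff)
      have "L' * dist x y \<le> (L + d) * dist x y"
        using L'(1) by (intro mult_right_mono) auto
      then show "dist (f x) (f y) \<le> L * dist x y + e"
        using L'(2) d by (simp add: dist_real_def algebra_simps)
    qed
  qed
next
  assume L: "L-lipschitz_on S f"
  show "Lip f S \<le> ereal L"
  proof (rule ereal_le_epsilon2)
    fix e :: real assume e: "e > 0"
    have "\<bar>f x - f y\<bar> \<le> (L + e) * dist x y" if "x \<in> S" "y \<in> S" for x y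
    proof -
      have "\<bar>f x - f y\<bar> \<le> L * dist x y"
        using lipschitz_onD[OF L that] by (simp add: dist_real_def)
      also have "\<dots> \<le> (L + e) * dist x y"
        using e by (intro mult_right_mono) auto
      finally show ?thesis .
    qed
    then have "Lip f S \<le> ereal (L + e)"
      unfolding Lip_def using e assms by (intro Inf_lower) auto
    then show "Lip f S \<le> ereal L + ereal e" by simp
  qed
qed

lemma Lip_nonneg: "Lip f S \<ge> 0"
  unfolding Lip_def by (rule Inf_greatest) auto

lemma lip_approximableI:
  assumes "\<And>(f :: 'a::real_normed_vector \<Rightarrow> real) \<eta>. (\<exists>L. L-lipschitz_on UNIV f) \<Longrightarrow> \<eta> > 0 \<Longrightarrow>
      \<exists>g :: 'a \<Rightarrow> real. Ck_on k g UNIV \<and> (\<forall>x. \<bar>f x - g x\<bar> \<le> \<eta>) \<and>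
        (\<forall>x0 r. r > 0 \<longrightarrow> Lip g (cball x0 r) \<le> Lip f (cball x0 (r + \<eta>)) + ereal \<eta>)"
  shows "lip_approximable k TYPE('a)"
  unfolding lip_approximable_def
proof (intro allI impI)
  fix f :: "'a \<Rightarrow> real" and \<eta> :: real
  assume f: "\<exists>L. L-lipschitz_on UNIV f" and \<eta>: "\<eta> > 0"
  obtain g where g: "Ck_on k g UNIV" "\<forall>x. \<bar>f x - g x\<bar> \<le> \<eta>"
    and lip: "\<And>r. r > 0 \<Longrightarrow> Lip g (cball 0 r) \<le> Lip f (cball 0 (r + \<eta>)) + ereal \<eta>"
    using assms[OF f \<eta>] by blast
  have "(M + \<eta>)-lipschitz_on (cball 0 r) g" if "r > 0" "M-lipschitz_on (cball 0 (r + \<eta>)) f" for r M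
  proof -
    have M: "M \<ge> 0" using that(2) by (rule lipschitz_on_nonneg)
    then have "Lip f (cball 0 (r + \<eta>)) + ereal \<eta> \<le> ereal M + ereal \<eta>"
      using that(2) Lip_le_ereal_iff by (intro add_right_mono) blast
    then have "Lip g (cball 0 r) \<le> ereal (M + \<eta>)"
      using lip[OF that(1)] by simp
    then show ?thesis
      using M \<eta> Lip_le_ereal_iff[of "M + \<eta>" g "cball 0 r"] by simp
  qed
  with g show "\<exists>g. Ck_on k g UNIV \<and> (\<forall>x. \<bar>f x - g x\<bar> \<le> \<eta>) \<and>
      (\<forall>r>0. \<forall>M. M-lipschitz_on (cball 0 (r + \<eta>)) f \<longrightarrow> (M + \<eta>)-lipschitz_on (cball 0 r) g)"
    by blast
qed

lemma lip_approximableD: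
  fixes f :: "'a::real_normed_vector \<Rightarrow> real"
  assumes "lip_approximable k TYPE('a)" "L-lipschitz_on UNIV f" "\<eta> > 0"
  obtains g where "Ck_on k g UNIV" "\<And>x. \<bar>f x - g x\<bar> \<le> \<eta>"
    "\<And>r M. r > 0 \<Longrightarrow> M-lipschitz_on (cball 0 (r + \<eta>)) f \<Longrightarrow> (M + \<eta>)-lipschitz_on (cball 0 r) g"
  using assms unfolding lip_approximable_def by metis

text \<open>Rescale \<open>q\<close> to \<open>f\<close> with \<open>f \<ge> 2\<close> where \<open>q \<le> a\<close> and \<open>f \<le> -1\<close> where \<open>q \<ge> b\<close>. An approximation of \<open>f\<close> up
  to 1 is then at least 1 on the first set and at most 0 on the second, which is where the smooth step
  is constant.\<close>

lemma smooth_cutoff_exists: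
  fixes q :: "'a::real_normed_vector \<Rightarrow> real"
  assumes "lip_approximable k TYPE('a)" "L-lipschitz_on UNIV q" "a < b"
  obtains \<phi> :: "'a \<Rightarrow> real" and M where "Ck_on k \<phi> UNIV" "M-lipschitz_on UNIV \<phi>" "\<And>x. 0 \<le> \<phi> x" "\<And>x. \<phi> x \<le> 1"
    "\<And>x. q x \<le> a \<Longrightarrow> \<phi> x = 0" "\<And>x. q x \<ge> b \<Longrightarrow> \<phi> x = 1"
proof -
  define c where "c = 3 / (b - a)"
  have "c > 0"
    using assms(3) by (simp add: c_def)
  moreover have "c * (b - a) = 3"
    using assms(3) by (intro nonzero_eq_divide_eq[THEN iffD1]) (auto simp: c_def)
  ultimately have c: "c > 0" "c * (b - a) = 3" .
  define f where "f x = 2 - c * (q x - a)" for x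
  have f: "(c * L)-lipschitz_on UNIV f"
  proof (rule lipschitz_onI)
    fix x y
    have "c * \<bar>q x - q y\<bar> \<le> c * (L * dist x y)"
      using lipschitz_onD[OF assms(2), of x y] c by (intro mult_left_mono) (auto simp: dist_real_def)
    moreover have "\<bar>f x - f y\<bar> = c * \<bar>q x - q y\<bar>"
    proof -
      have "f x - f y = (- c) * (q x - q y)" by (simp add: f_def algebra_simps)
      then show ?thesis using c by (simp only: abs_mult)
    qed
    ultimately show "dist (f x) (f y) \<le> c * L * dist x y"
      by (simp add: dist_real_def mult.assoc)
  qed (use c lipschitz_on_nonneg[OF assms(2)] in simp)
  obtain g where g: "Ck_on k g UNIV" "\<And>x. \<bar>f x - g x\<bar> \<le> 1"
    and gl: "\<And>r M. r > 0 \<Longrightarrow> M-lipschitz_on (cball 0 (r + 1)) f \<Longrightarrow> (M + 1)-lipschitz_on (cball 0 r) g"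
    using lip_approximableD[OF assms(1) f zero_less_one] by metis
  have g_lip: "(c * L + 1)-lipschitz_on UNIV g"
  proof (rule lipschitz_onI)
    fix x y :: 'a
    define r where "r = norm x + norm y + 1"
    have "(c * L)-lipschitz_on (cball 0 (r + 1)) f"
      using f by (rule lipschitz_on_subset) simp
    then have "(c * L + 1)-lipschitz_on (cball 0 r) g"
      by (intro gl) (auto simp: r_def add_nonneg_pos)
    moreover have "x \<in> cball 0 r" "y \<in> cball 0 r"
      by (auto simp: r_def add_increasing add_increasing2)
    ultimately show "dist (g x) (g y) \<le> (c * L + 1) * dist x y"
      by (rule lipschitz_onD)
  qed (use lipschitz_on_nonneg[OF f] in simp)
  obtain h1 h2 M where h: "smooth_real h1" "smooth_real h2" "M-lipschitz_on UNIV (\<lambda>t. h2 (h1 t))"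
    "\<And>t. 0 \<le> h2 (h1 t)" "\<And>t. h2 (h1 t) \<le> 1"
    "\<And>t. t \<le> 0 \<Longrightarrow> h2 (h1 t) = 1" "\<And>t. t \<ge> 1 \<Longrightarrow> h2 (h1 t) = 0"
    using smooth_step_exists by metis
  show ?thesis
  proof (rule that[of "\<lambda>x. h2 (h1 (g x))" "M * (c * L + 1)"])
    show "Ck_on k (\<lambda>x. h2 (h1 (g x))) UNIV"
      by (rule Ck_on_compose[OF open_UNIV h(2) Ck_on_compose[OF open_UNIV h(1) g(1)]])
    have "M-lipschitz_on (range g) (\<lambda>t. h2 (h1 t))"
      using h(3) by (rule lipschitz_on_subset) simp
    from lipschitz_on_compose[OF g_lip this]
    show "(M * (c * L + 1))-lipschitz_on UNIV (\<lambda>x. h2 (h1 (g x)))"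
      by (simp add: o_def)
    show "h2 (h1 (g x)) = 0" if "q x \<le> a" for x
    proof -
      have "c * (q x - a) \<le> 0" using c that by (simp add: mult_nonneg_nonpos)
      then have "g x \<ge> 1" using g(2)[of x] by (simp add: f_def)
      then show ?thesis by (rule h)
    qed
    show "h2 (h1 (g x)) = 1" if "q x \<ge> b" for x
    proof -
      have "c * (b - a) \<le> c * (q x - a)" using c that by (intro mult_left_mono) auto
      then have "g x \<le> 0" using g(2)[of x] c by (simp add: f_def)
      then show ?thesis by (rule h)
    qed
  qed (use h in auto)
qed

section \<open>Lipschitz extensions with locally smaller constant\<close>

lemma lipschitz_on_min:
  fixes f g :: "'a::metric_space \<Rightarrow> real"
  assumes "L-lipschitz_on S f" "L-lipschitz_on S g"
  shows "L-lipschitz_on S (\<lambda>x. min (f x) (g x))"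
proof (rule lipschitz_onI)
  fix x y assume xy: "x \<in> S" "y \<in> S"
  show "dist (min (f x) (g x)) (min (f y) (g y)) \<le> L * dist x y"
    using lipschitz_onD[OF assms(1) xy] lipschitz_onD[OF assms(2) xy]
    by (auto simp: dist_real_def min_def)
qed (use assms lipschitz_on_nonneg in blast)

text \<open>An infimum of \<open>L\<close>-Lipschitz functions is \<open>L\<close>-Lipschitz. Since only indices \<open>y\<close> that nearly attain the
  infimum matter, the Lipschitz estimate may be restricted to them.\<close>

lemma lipschitz_on_INF:
  fixes F :: "'b \<Rightarrow> 'a::metric_space \<Rightarrow> real"
  assumes "S \<noteq> {}" "L \<ge> 0" "\<And>x. x \<in> B \<Longrightarrow> bdd_below ((\<lambda>y. F y x) ` S)"
    and near: "\<And>x x' y. x \<in> B \<Longrightarrow> x' \<in> B \<Longrightarrow> y \<in> S \<Longrightarrow> F y x' \<le> (INF y\<in>S. F y x') + 1 \<Longrightarrow>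
      F y x - F y x' \<le> L * dist x x'"
  shows "L-lipschitz_on B (\<lambda>x. INF y\<in>S. F y x)"
proof (rule lipschitz_onI[OF _ assms(2)])
  let ?G = "\<lambda>x. INF y\<in>S. F y x"
  have le: "?G x - ?G x' \<le> L * dist x x'" if x: "x \<in> B" "x' \<in> B" for x x'
  proof (rule field_le_epsilon)
    fix e :: real assume "e > 0"
    then have "?G x' < ?G x' + min e 1" by simp
    then obtain y where y: "y \<in> S" "F y x' < ?G x' + min e 1"
      using cINF_less_iff[OF assms(1) assms(3)[OF x(2)]] by blast
    have "?G x \<le> F y x"
      using assms(3)[OF x(1)] y(1) by (rule cINF_lower)
    moreover have "F y x - F y x' \<le> L * dist x x'"
      using x y by (intro near) auto
    ultimately show "?G x - ?G x' \<le> L * dist x x' + e"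
      using y(2) by linarith
  qed
  fix x x' assume "x \<in> B" "x' \<in> B"
  then show "dist (?G x) (?G x') \<le> L * dist x x'"
    using le[of x x'] le[of x' x] by (simp add: dist_real_def dist_commute abs_le_iff)
qed

text \<open>McShane's extension: the lower envelope of the cones of slope \<open>K\<close> over the graph of \<open>f\<close>.\<close>

lemma lipschitz_on_extend_UNIV:
  fixes f :: "'a::metric_space \<Rightarrow> real"
  assumes f: "K-lipschitz_on S f"
  obtains g where "K-lipschitz_on UNIV g" "\<And>x. x \<in> S \<Longrightarrow> g x = f x"
proof (cases "S = {}")
  case True
  show ?thesis
    by (rule that[of "\<lambda>_. 0"]) (use True lipschitz_on_nonneg[OF f] in \<open>auto intro: lipschitz_onI\<close>)
next
  case False
  then obtain y0 where y0: "y0 \<in> S" by blast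
  define g where "g x = (INF y\<in>S. f y + K * dist x y)" for x
  have K: "K \<ge> 0" using f by (rule lipschitz_on_nonneg)
  have fle: "f z - f y \<le> K * dist z y" if "y \<in> S" "z \<in> S" for y z
    using lipschitz_onD[OF f that(2,1)] by (simp add: dist_real_def)
  have lower: "f z - K * dist x z \<le> f y + K * dist x y" if "y \<in> S" "z \<in> S" for x y z
  proof -
    have "K * dist z y \<le> K * (dist x z + dist x y)"
      by (intro mult_left_mono K dist_triangle3)
    then show ?thesis
      using fle[OF that] by (simp add: distrib_left)
  qed
  then have bdd: "bdd_below ((\<lambda>y. f y + K * dist x y) ` S)" for x
    using y0 by (intro bdd_belowI2[of _ "f y0 - K * dist x y0"])
  show ?thesis
  proof (rule that)
    show "K-lipschitz_on UNIV g"
      unfolding g_def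
    proof (rule lipschitz_on_INF[OF False K bdd])
      fix x x' y :: 'a
      have "K * dist x y \<le> K * (dist x x' + dist x' y)"
        by (intro mult_left_mono K dist_triangle)
      then show "f y + K * dist x y - (f y + K * dist x' y) \<le> K * dist x x'"
        by (simp add: distrib_left)
    qed
    fix x assume x: "x \<in> S"
    have "g x \<le> f x + K * dist x x"
      unfolding g_def using bdd x by (rule cINF_lower)
    moreover have "f x \<le> g x"
      unfolding g_def using False lower[OF _ x, of _ x] by (intro cINF_greatest) auto
    ultimately show "g x = f x" by simp
  qed
qed

text \<open>McShane's extension with the cone \<open>K * t\<close> replaced by \<open>\<theta> t = K * t - c * t / (1 + t)\<close>. Its slope is
  between \<open>K - c > K0\<close> and \<open>K\<close>, so the values on \<open>S\<close> are kept, and it is less than \<open>K\<close> everywhere. As \<open>\<theta>\<close>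
  grows faster than \<open>f\<close> can decrease, for \<open>x\<close> in a ball only the points \<open>y\<close> at a bounded distance \<open>T\<close>
  compete in the infimum, and on \<open>{0..T}\<close> the slope of \<open>\<theta>\<close> is at most \<open>K - c / (1 + T)\<^sup>2\<close>. The last
  conclusion says that the extension is lower than McShane's by at most \<open>\<epsilon>\<close>.\<close>

lemma extension_locally_below_constant:
  fixes f :: "'a::real_normed_vector \<Rightarrow> real"
  assumes f: "K0-lipschitz_on S f" and "S \<noteq> {}" "K0 < K" "\<epsilon> > 0"
  obtains g where "\<And>R. \<exists>L<K. L-lipschitz_on (cball 0 R) g" "\<And>x. x \<in> S \<Longrightarrow> g x = f x"
    "\<And>x m. (\<And>y. y \<in> S \<Longrightarrow> m \<le> f y + K * dist x y) \<Longrightarrow> m - \<epsilon> \<le> g x"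
proof -
  obtain y0 where y0: "y0 \<in> S" using assms(2) by blast
  have K0: "K0 \<ge> 0" using f by (rule lipschitz_on_nonneg)
  define c where "c = min \<epsilon> ((K - K0) / 2)"
  have c: "c > 0" "c \<le> \<epsilon>" "K0 < K - c"
    using assms(3,4) by (auto simp: c_def min_def field_simps)
  define \<theta> where "\<theta> t = K * t - c * (t / (1 + t))" for t
  have frac: "0 \<le> t / (1 + t)" "t / (1 + t) \<le> 1" "t / (1 + t) \<le> t" if "t \<ge> 0" for t :: real
    using that by (auto simp: field_simps)
  have \<theta>_ge: "(K - c) * t \<le> \<theta> t" "K * t - c \<le> \<theta> t" and \<theta>_le: "\<theta> t \<le> K * t" if "t \<ge> 0" for t
    using c(1) frac[OF that] mult_left_mono[of "t / (1 + t)" t c] mult_left_mono[of "t / (1 + t)" 1 c]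
    by (auto simp: \<theta>_def algebra_simps)
  have \<theta>_diff: "\<theta> t - \<theta> s \<le> (K - c / (1 + T)\<^sup>2) * \<bar>t - s\<bar>"
    if st: "0 \<le> s" "s \<le> T" "0 \<le> t" "t \<le> T" for s t T
  proof -
    have "t / (1 + t) - s / (1 + s) = (t - s) / ((1 + t) * (1 + s))"
    proof -
      have "t * (1 + s) - s * (1 + t) = t - s" by (simp add: algebra_simps)
      then show ?thesis
        using st diff_frac_eq[of "1 + t" "1 + s" t s] by simp
    qed
    moreover have "\<theta> t - \<theta> s = K * (t - s) - c * (t / (1 + t) - s / (1 + s))"
      unfolding \<theta>_def right_diff_distrib by simp
    ultimately have eq: "\<theta> t - \<theta> s = (K - c / ((1 + t) * (1 + s))) * (t - s)"
      by (simp only: left_diff_distrib times_divide_eq_left times_divide_eq_right)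
    have "(1 + t) * (1 + s) \<le> (1 + T)\<^sup>2"
      unfolding power2_eq_square using st by (intro mult_mono) auto
    then have "c / (1 + T)\<^sup>2 \<le> c / ((1 + t) * (1 + s))"
      using c st by (intro divide_left_mono) auto
    moreover have "1 * 1 \<le> (1 + t) * (1 + s)"
      using st by (intro mult_mono) auto
    then have "c / ((1 + t) * (1 + s)) \<le> c / 1"
      using c by (intro divide_left_mono) auto
    ultimately have k: "0 \<le> K - c / ((1 + t) * (1 + s))" "K - c / ((1 + t) * (1 + s)) \<le> K - c / (1 + T)\<^sup>2"
      using c K0 by auto
    have "(K - c / ((1 + t) * (1 + s))) * (t - s) \<le> (K - c / ((1 + t) * (1 + s))) * \<bar>t - s\<bar>"
      using k(1) by (intro mult_left_mono) auto
    also have "\<dots> \<le> (K - c / (1 + T)\<^sup>2) * \<bar>t - s\<bar>"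
      using k(2) by (intro mult_right_mono) auto
    finally show ?thesis unfolding eq .
  qed
  define g where "g x = (INF y\<in>S. f y + \<theta> (dist x y))" for x
  have fle: "f z - f y \<le> K0 * dist z y" if "y \<in> S" "z \<in> S" for y z
    using lipschitz_onD[OF f that(2,1)] by (simp add: dist_real_def)
  have lower: "f z - K0 * dist x z + (K - c - K0) * dist x y \<le> f y + \<theta> (dist x y)"
    if "y \<in> S" "z \<in> S" for x y z
  proof -
    have "K0 * dist z y \<le> K0 * (dist x z + dist x y)"
      by (intro mult_left_mono K0 dist_triangle3)
    then show ?thesis
      using fle[OF that] \<theta>_ge(1)[of "dist x y"] by (simp add: algebra_simps)
  qed
  have lower': "f z - K0 * dist x z \<le> f y + \<theta> (dist x y)" if "y \<in> S" "z \<in> S" for x y z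
  proof -
    have "0 \<le> (K - c - K0) * dist x y"
      using c(3) by (intro mult_nonneg_nonneg) auto
    then show ?thesis using lower[OF that, of x] by linarith
  qed
  then have bdd: "bdd_below ((\<lambda>y. f y + \<theta> (dist x y)) ` S)" for x
    using y0 by (intro bdd_belowI2[of _ "f y0 - K0 * dist x y0"])
  show ?thesis
  proof (rule that)
    fix R :: real
    \<comment> \<open>\<open>D\<close> bounds the distance from a point of the ball to an index that nearly attains the infimum there.\<close>
    define D where "D = ((K + K0) * (\<bar>R\<bar> + norm y0) + 1) / (K - c - K0)"
    define T where "T = D + 2 * \<bar>R\<bar>"
    have "D \<ge> 0"
      unfolding D_def using c K0 assms(3)
      by (intro divide_nonneg_nonneg add_nonneg_nonneg mult_nonneg_nonneg) auto
    then have T: "T \<ge> 0" by (simp add: T_def)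
    then have "(1 + T)\<^sup>2 \<ge> 1" by simp
    then have cT: "c / (1 + T)\<^sup>2 \<le> c / 1"
      using c by (intro divide_left_mono) auto
    have "(K - c / (1 + T)\<^sup>2)-lipschitz_on (cball 0 R) g"
      unfolding g_def
    proof (rule lipschitz_on_INF[OF assms(2) _ bdd])
      show L0: "0 \<le> K - c / (1 + T)\<^sup>2"
        using cT c K0 by simp
      fix x x' y :: 'a assume x: "x \<in> cball 0 R" "x' \<in> cball 0 R" and y: "y \<in> S"
        and min: "f y + \<theta> (dist x' y) \<le> (INF y\<in>S. f y + \<theta> (dist x' y)) + 1"
      have x'y0: "dist x' y0 \<le> \<bar>R\<bar> + norm y0"
        using x(2) norm_triangle_ineq4[of x' y0] by (simp add: dist_norm)
      have "(INF y\<in>S. f y + \<theta> (dist x' y)) \<le> f y0 + \<theta> (dist x' y0)"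
        using bdd y0 by (rule cINF_lower)
      with min lower[OF y y0, of x'] \<theta>_le[of "dist x' y0"]
      have "(K - c - K0) * dist x' y \<le> (K + K0) * dist x' y0 + 1"
        by (simp add: algebra_simps)
      also have "\<dots> \<le> (K + K0) * (\<bar>R\<bar> + norm y0) + 1"
        using K0 assms(3) x'y0 by (intro add_mono mult_left_mono) auto
      finally have "dist x' y \<le> D"
        using c(3) by (simp add: D_def pos_le_divide_eq mult.commute)
      moreover have "dist x y \<le> dist x x' + dist x' y"
        by (rule dist_triangle)
      moreover have "dist x x' \<le> 2 * \<bar>R\<bar>"
        using x norm_triangle_ineq4[of x x'] by (simp add: dist_norm)
      ultimately have "dist x' y \<le> T" "dist x y \<le> T"
        by (auto simp: T_def)
      then have "\<theta> (dist x y) - \<theta> (dist x' y) \<le> (K - c / (1 + T)\<^sup>2) * \<bar>dist x y - dist x' y\<bar>"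
        by (intro \<theta>_diff) auto
      also have "\<dots> \<le> (K - c / (1 + T)\<^sup>2) * dist x x'"
        using abs_dist_diff_le[of x y x'] L0 by (intro mult_left_mono) (simp_all add: dist_commute)
      finally show "f y + \<theta> (dist x y) - (f y + \<theta> (dist x' y)) \<le> (K - c / (1 + T)\<^sup>2) * dist x x'"
        by simp
    qed
    moreover have "K - c / (1 + T)\<^sup>2 < K"
      using c T by simp
    ultimately show "\<exists>L<K. L-lipschitz_on (cball 0 R) g" by blast
  next
    fix x assume x: "x \<in> S"
    have "g x \<le> f x + \<theta> (dist x x)"
      unfolding g_def using bdd x by (rule cINF_lower)
    moreover have "f x \<le> g x"
      unfolding g_def using assms(2) lower'[OF _ x, of _ x] by (intro cINF_greatest) auto
    ultimately show "g x = f x" by (simp add: \<theta>_def)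
  next
    fix x :: 'a and m assume m: "\<And>y. y \<in> S \<Longrightarrow> m \<le> f y + K * dist x y"
    have "m - \<epsilon> \<le> f y + \<theta> (dist x y)" if "y \<in> S" for y
      using m[OF that] \<theta>_ge(2)[of "dist x y"] c(2) by simp
    then show "m - \<epsilon> \<le> g x"
      unfolding g_def using assms(2) by (intro cINF_greatest)
  qed
qed

text \<open>The slope of \<open>\<psi> t = t + c * (pi / 2 - arctan t)\<close> is \<open>1 - c / (1 + t\<^sup>2)\<close>, which tends to 1 at infinity
  fast enough for \<open>\<psi> t - t\<close> to stay bounded.\<close>

lemma upward_contraction_exists:
  assumes "\<epsilon> > 0"
  obtains \<psi> :: "real \<Rightarrow> real" where "\<And>t. t \<le> \<psi> t" "\<And>t. \<psi> t \<le> t + \<epsilon>"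
    "\<And>M. \<exists>L. 0 \<le> L \<and> L < 1 \<and> L-lipschitz_on (cball 0 M) \<psi>"
proof -
  define c where "c = min (\<epsilon> / pi) 1"
  have c: "c > 0" "c * pi \<le> \<epsilon>" "c \<le> 1"
    using assms by (auto simp: c_def min_def field_simps)
  define \<psi> where "\<psi> t = t + c * (pi / 2 - arctan t)" for t
  show ?thesis
  proof (rule that)
    fix t :: real
    have b: "0 \<le> pi / 2 - arctan t" "pi / 2 - arctan t \<le> pi"
      using arctan_bounded[of t] by auto
    show "t \<le> \<psi> t"
      using b c by (simp add: \<psi>_def)
    have "c * (pi / 2 - arctan t) \<le> c * pi"
      using b c by (intro mult_left_mono) auto
    then show "\<psi> t \<le> t + \<epsilon>"
      using c(2) unfolding \<psi>_def by linarith
  next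
    fix M :: real
    define L where "L = 1 - c / (1 + M\<^sup>2)"
    have "c / (1 + M\<^sup>2) \<le> 1 / 1"
      using c by (intro frac_le) auto
    then have L: "0 \<le> L" "L < 1"
      using c by (auto simp: L_def intro!: divide_pos_pos add_pos_nonneg)
    have "L-lipschitz_on (cball 0 M) \<psi>"
    proof (rule bounded_derivative_imp_lipschitz)
      fix t :: real assume t: "t \<in> cball 0 M"
      have "(\<psi> has_real_derivative (1 - c * inverse (1 + t\<^sup>2))) (at t within cball 0 M)"
        unfolding \<psi>_def by (auto intro!: derivative_eq_intros)
      then show "(\<psi> has_derivative (*) (1 - c * inverse (1 + t\<^sup>2))) (at t within cball 0 M)"
        by (simp add: has_field_derivative_def)
      have "t\<^sup>2 \<le> M\<^sup>2"
        using t by (simp add: abs_le_square_iff[symmetric])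
      then have "c / (1 + M\<^sup>2) \<le> c / (1 + t\<^sup>2)"
        using c by (intro divide_left_mono mult_pos_pos add_pos_nonneg) auto
      moreover have "c / (1 + t\<^sup>2) \<le> 1 / 1"
        using c by (intro frac_le) auto
      ultimately have "\<bar>1 - c * inverse (1 + t\<^sup>2)\<bar> \<le> L"
        by (simp add: L_def divide_inverse)
      then show "onorm ((*) (1 - c * inverse (1 + t\<^sup>2))) \<le> L"
        by (intro onorm_le) (simp add: abs_mult mult_right_mono)
    qed (use L in auto)
    with L show "\<exists>L. 0 \<le> L \<and> L < 1 \<and> L-lipschitz_on (cball 0 M) \<psi>" by blast
  qed
qed

text \<open>The composition \<open>p\<close> of \<open>\<psi>\<close> with an extension of \<open>u\<close> has locally smaller constants and lies between \<open>u\<close>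
  and \<open>u + \<epsilon>\<close> on \<open>C\<close>. The function \<open>h\<close> extends \<open>u\<close> from \<open>F\<close> with locally smaller constants and is at
  least \<open>u - \<epsilon>\<close> on \<open>C\<close>, because \<open>u x \<le> u y + K * dist x y\<close>. Both properties
  pass to \<open>min h p\<close>. On \<open>F\<close> this is \<open>u\<close>, because the error of \<open>p\<close> is upwards only. If \<open>F\<close> is empty, \<open>p\<close>
  alone suffices.\<close>

lemma locally_below_constant_approximation:
  fixes u :: "'a::real_normed_vector \<Rightarrow> real"
  assumes u: "K-lipschitz_on C u" and F: "F \<subseteq> C" "K0-lipschitz_on F u" and "K0 < K" "\<epsilon> > 0"
  obtains w where "\<And>R. \<exists>L<K. L-lipschitz_on (cball 0 R) w" "\<And>x. x \<in> F \<Longrightarrow> w x = u x"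
    "\<And>x. x \<in> C \<Longrightarrow> \<bar>u x - w x\<bar> \<le> \<epsilon>"
proof -
  obtain g where g: "K-lipschitz_on UNIV g" "\<And>x. x \<in> C \<Longrightarrow> g x = u x"
    using lipschitz_on_extend_UNIV[OF u] by metis
  have K: "K > 0"
    using lipschitz_on_nonneg[OF F(2)] assms(4) by simp
  obtain \<psi> where \<psi>: "\<And>t. t \<le> \<psi> t" "\<And>t. \<psi> t \<le> t + \<epsilon>"
    and \<psi>l: "\<And>M. \<exists>L. 0 \<le> L \<and> L < 1 \<and> L-lipschitz_on (cball 0 M) \<psi>"
    using upward_contraction_exists[OF assms(5)] by metis
  define p where "p x = \<psi> (g x)" for x
  have p_lip: "\<exists>L<K. L-lipschitz_on (cball 0 R) p" for R
  proof -
    define M where "M = \<bar>g 0\<bar> + K * \<bar>R\<bar>"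
    obtain L where L: "0 \<le> L" "L < 1" "L-lipschitz_on (cball 0 M) \<psi>"
      using \<psi>l by blast
    have "g ` cball 0 R \<subseteq> cball 0 M"
    proof clarify
      fix x :: 'a assume "x \<in> cball 0 R"
      then have "K * norm x \<le> K * \<bar>R\<bar>"
        using K by (intro mult_left_mono) auto
      moreover have "\<bar>g x - g 0\<bar> \<le> K * norm x"
        using lipschitz_onD[OF g(1), of x 0] by (simp add: dist_real_def)
      ultimately show "g x \<in> cball 0 M"
        by (simp add: M_def)
    qed
    then have "L-lipschitz_on (g ` cball 0 R) \<psi>"
      using L(3) by (rule lipschitz_on_subset[rotated])
    moreover have "K-lipschitz_on (cball 0 R) g"
      using g(1) by (rule lipschitz_on_subset) simp
    ultimately have "(L * K)-lipschitz_on (cball 0 R) p"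
      using lipschitz_on_compose[of K "cball 0 R" g L \<psi>] by (simp add: p_def[abs_def] o_def)
    moreover have "L * K < K" using L K by simp
    ultimately show ?thesis by blast
  qed
  have p_close: "u x \<le> p x" "p x \<le> u x + \<epsilon>" if "x \<in> C" for x
    using \<psi> g(2)[OF that] by (simp_all add: p_def)
  show ?thesis
  proof (cases "F = {}")
    case True
    show ?thesis
    proof (rule that[of p, OF p_lip])
      show "\<bar>u x - p x\<bar> \<le> \<epsilon>" if "x \<in> C" for x
        using p_close[OF that] by linarith
    qed (use True in simp)
  next
    case False
    obtain h where h: "\<And>R. \<exists>L<K. L-lipschitz_on (cball 0 R) h" "\<And>x. x \<in> F \<Longrightarrow> h x = u x"
      and h_ge: "\<And>x m. (\<And>y. y \<in> F \<Longrightarrow> m \<le> u y + K * dist x y) \<Longrightarrow> m - \<epsilon> \<le> h x"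
      using extension_locally_below_constant[OF F(2) False assms(4,5)] by metis
    show ?thesis
    proof (rule that[of "\<lambda>x. min (h x) (p x)"])
      fix R :: real
      obtain L1 where L1: "L1 < K" "L1-lipschitz_on (cball 0 R) h"
        using h(1) by blast
      obtain L2 where L2: "L2 < K" "L2-lipschitz_on (cball 0 R) p"
        using p_lip by blast
      have "(max L1 L2)-lipschitz_on (cball 0 R) (\<lambda>x. min (h x) (p x))"
        by (intro lipschitz_on_min lipschitz_on_le[OF L1(2)] lipschitz_on_le[OF L2(2)]) auto
      then show "\<exists>L<K. L-lipschitz_on (cball 0 R) (\<lambda>x. min (h x) (p x))"
        using L1 L2 by (intro exI[of _ "max L1 L2"]) auto
    next
      fix x assume x: "x \<in> F"
      then show "min (h x) (p x) = u x"
        using h(2)[OF x] p_close(1)[of x] F(1) by (auto simp: min_def)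
    next
      fix x assume x: "x \<in> C"
      have "u x \<le> u y + K * dist x y" if "y \<in> F" for y
        using lipschitz_onD[OF u x, of y] that F(1) by (auto simp: dist_real_def)
      then have "u x - \<epsilon> \<le> h x" by (rule h_ge)
      then show "\<bar>u x - min (h x) (p x)\<bar> \<le> \<epsilon>"
        using p_close[OF x] by (simp add: min_def abs_le_iff)
    qed
  qed
qed

section \<open>Smooth perturbation on an open set\<close>

text \<open>The minimum of the distance to the complement and of \<open>1 / (2 + norm x)\<close>. The second term makes
  superlevel sets of positive level bounded. For \<open>U = UNIV\<close> the distance is replaced by 1, since
  \<open>infdist\<close> to the empty set is 0.\<close>

lemma exhaustion_function_exists:
  fixes U :: "'a::real_normed_vector set"
  assumes "open U"
  obtains q :: "'a \<Rightarrow> real" where "1-lipschitz_on UNIV q" "\<And>x. q x \<le> 1 / (2 + norm x)"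
    "{x. q x > 0} = U" "\<And>x. x \<notin> U \<Longrightarrow> q x = 0"
proof -
  define d where "d x = (if U = UNIV then 1 else infdist x (- U))" for x
  define e where "e x = 1 / (2 + norm x)" for x :: 'a
  have d: "d x \<ge> 0" "d x > 0 \<longleftrightarrow> x \<in> U" for x
  proof -
    show "d x \<ge> 0" by (simp add: d_def infdist_nonneg)
    have "infdist x (- U) = 0 \<longleftrightarrow> x \<notin> U" if "U \<noteq> UNIV"
      using in_closed_iff_infdist_zero[of "- U" x] that assms by auto
    then show "d x > 0 \<longleftrightarrow> x \<in> U"
      using infdist_nonneg[of x "- U"] by (auto simp: d_def less_le)
  qed
  have e: "e x > 0" for x
    by (simp add: e_def add_pos_nonneg)
  have d_lip: "1-lipschitz_on UNIV d"
    by (rule lipschitz_onI) (auto simp: d_def dist_real_def infdist_triangle_abs)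
  have e_lip: "1-lipschitz_on UNIV e"
  proof (rule lipschitz_onI)
    fix x y :: 'a
    have p: "0 < 2 + norm x" "0 < 2 + norm y"
      by (simp_all add: add_pos_nonneg)
    have P: "1 * 1 \<le> (2 + norm x) * (2 + norm y)"
      by (intro mult_mono) auto
    have "e x - e y = (norm y - norm x) / ((2 + norm x) * (2 + norm y))"
      unfolding e_def using p diff_frac_eq[of "2 + norm x" "2 + norm y" 1 1] by simp
    then have "\<bar>e x - e y\<bar> = \<bar>norm y - norm x\<bar> / ((2 + norm x) * (2 + norm y))"
      using p by (simp add: abs_divide abs_mult)
    also have "\<dots> \<le> \<bar>norm y - norm x\<bar> / 1"
      using P by (intro divide_left_mono) auto
    also have "\<dots> \<le> dist x y"
      using norm_triangle_ineq3[of y x] by (simp add: dist_norm norm_minus_commute)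
    finally show "dist (e x) (e y) \<le> 1 * dist x y"
      by (simp add: dist_real_def)
  qed simp
  show ?thesis
  proof (rule that[of "\<lambda>x. min (d x) (e x)"])
    show "1-lipschitz_on UNIV (\<lambda>x. min (d x) (e x))"
      by (rule lipschitz_on_min[OF d_lip e_lip])
    show "min (d x) (e x) \<le> 1 / (2 + norm x)" for x
      by (simp add: e_def)
    show "{x. min (d x) (e x) > 0} = U"
      using d(2) e by auto
    show "min (d x) (e x) = 0" if "x \<notin> U" for x
      using that d[of x] e[of x] by (auto simp: min_def)
  qed
qed

text \<open>Let \<open>l n = 1 / 2 ^ n\<close> and let \<open>g n\<close> be smooth approximations of \<open>w\<close> with errors \<open>\<eta> n\<close>. For each \<open>n\<close> a
  cutoff \<open>\<phi> n\<close> is 1 where \<open>q \<ge> l (n + 1)\<close> and 0 where \<open>q \<le> a (n + 1)\<close>, with \<open>a (n + 1)\<close> strictly between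
  \<open>l (n + 2)\<close> and \<open>l (n + 1)\<close>. The open sets \<open>T n = {l (n + 2) < q < a n}\<close> cover \<open>{q > 0}\<close>, and on \<open>T n\<close> the
  function \<open>v\<close> is the convex combination \<open>P n\<close> of \<open>g n\<close> and \<open>g (n + 1)\<close> with weight \<open>\<phi> n\<close>. On the
  overlap of \<open>T n\<close> and \<open>T (n + 1)\<close> both combinations are \<open>g (n + 1)\<close>.

  With \<open>L n < K\<close> and \<open>M n\<close> the Lipschitz constants of \<open>w\<close> near \<open>T n\<close> and of \<open>\<phi> n\<close>, a Lipschitz constant of
  \<open>P n\<close> on \<open>T n\<close> is \<open>L n + (1 + M n) * (\<eta> n + \<eta> (n + 1))\<close>. Here 1 comes from approximating \<open>w\<close>, and \<open>M n\<close>
  from the variation of the weight, which is multiplied by \<open>g n - g (n + 1)\<close>. The choice of \<open>\<eta>\<close> makes this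
  at most \<open>K\<close>.\<close>

lemma smooth_perturbation:
  fixes w q :: "'a::real_normed_vector \<Rightarrow> real"
  assumes "lip_approximable k TYPE('a)"
    and w: "K-lipschitz_on UNIV w" "\<And>R. \<exists>L<K. L-lipschitz_on (cball 0 R) w"
    and q: "1-lipschitz_on UNIV q" "\<And>x. q x \<le> 1 / (2 + norm x)"
    and \<epsilon>: "\<epsilon> > 0"
  obtains v :: "'a \<Rightarrow> real" where "Ck_on k v {x. q x > 0}" "\<And>x. q x > 0 \<Longrightarrow> \<bar>w x - v x\<bar> \<le> \<epsilon>"
    "\<And>x. q x > 0 \<Longrightarrow> \<bar>w x - v x\<bar> \<le> q x"
    "\<And>x. q x > 0 \<Longrightarrow> \<exists>T. open T \<and> x \<in> T \<and> K-lipschitz_on T v"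
proof -
  define l :: "nat \<Rightarrow> real" where "l n = (1 / 2) ^ n" for n
  define a where "a n = 3 / 4 * l n" for n
  have l0: "l n > 0" and lSuc: "l (Suc n) = l n / 2" and la: "l (Suc n) < a n" "a n < l n" for n
    by (auto simp: l_def a_def)
  have ldec: "l m \<le> l n" if "n \<le> m" for m n
    using that by (simp add: l_def power_decreasing)

  define cutoff where "cutoff n \<phi> M \<longleftrightarrow> Ck_on k \<phi> UNIV \<and> M-lipschitz_on UNIV \<phi> \<and> (\<forall>x. 0 \<le> \<phi> x \<and> \<phi> x \<le> 1) \<and>
    (\<forall>x. q x \<le> a (Suc n) \<longrightarrow> \<phi> x = 0) \<and> (\<forall>x. q x \<ge> l (Suc n) \<longrightarrow> \<phi> x = 1)"
    for n and \<phi> :: "'a \<Rightarrow> real" and M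
  have "\<exists>\<phi> M. cutoff n \<phi> M" for n
    using smooth_cutoff_exists[OF assms(1) q(1) la(2)[of "Suc n"]] unfolding cutoff_def by metis
  then obtain \<phi> M where "\<And>n. cutoff n (\<phi> n) (M n)"
    by metis
  then have \<phi>: "\<And>n. Ck_on k (\<phi> n) UNIV" "\<And>n. (M n)-lipschitz_on UNIV (\<phi> n)"
    "\<And>n x. 0 \<le> \<phi> n x" "\<And>n x. \<phi> n x \<le> 1"
    and \<phi>0: "\<And>n x. q x \<le> a (Suc n) \<Longrightarrow> \<phi> n x = 0" and \<phi>1: "\<And>n x. q x \<ge> l (Suc n) \<Longrightarrow> \<phi> n x = 1"
    by (simp_all add: cutoff_def)
  have M: "M n \<ge> 0" for n
    using \<phi>(2) by (rule lipschitz_on_nonneg)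

  define r :: "nat \<Rightarrow> real" where "r n = 2 ^ (n + 2)" for n
  have "\<exists>L. L < K \<and> L-lipschitz_on (cball 0 (r n + 1)) w" for n
    using w(2) by blast
  then obtain L where L: "\<And>n. L n < K" "\<And>n. (L n)-lipschitz_on (cball 0 (r n + 1)) w"
    by metis
  \<comment> \<open>The admissible error on \<open>T n\<close> for each of the two approximations that are used there.\<close>
  define \<beta> where "\<beta> n = (K - L n) / (2 * (1 + M n))" for n
  have \<beta>: "\<beta> n > 0" "(1 + M n) * \<beta> n = (K - L n) / 2" for n
  proof -
    have c: "c * (x / (2 * c)) = x / 2" if "c > 0" for c x :: real
      using that by simp
    show "\<beta> n > 0"
      unfolding \<beta>_def using L(1)[of n] M[of n] by (intro divide_pos_pos) auto
    show "(1 + M n) * \<beta> n = (K - L n) / 2"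
      unfolding \<beta>_def by (rule c) (use M[of n] in simp)
  qed
  \<comment> \<open>The approximation \<open>g n\<close> is used on \<open>T n\<close> and on \<open>T (n - 1)\<close>. For \<open>n = 0\<close> the last entry repeats \<open>\<beta> 0\<close>.\<close>
  define \<eta> where "\<eta> n = Min {1, \<epsilon>, l (n + 2), \<beta> n, \<beta> (n - 1)}" for n
  have \<eta>: "\<eta> n > 0" "\<eta> n \<le> 1" "\<eta> n \<le> \<epsilon>" "\<eta> n \<le> l (n + 2)" "\<eta> n \<le> \<beta> n" "\<eta> (Suc n) \<le> \<beta> n" for n
    using \<epsilon> l0 \<beta> by (auto simp: \<eta>_def)
  have "\<exists>g :: 'a \<Rightarrow> real. Ck_on k g UNIV \<and> (\<forall>x. \<bar>w x - g x\<bar> \<le> \<eta> n) \<and>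
       (\<forall>r>0. \<forall>M. M-lipschitz_on (cball 0 (r + \<eta> n)) w \<longrightarrow> (M + \<eta> n)-lipschitz_on (cball 0 r) g)" for n
    using assms(1) w(1) \<eta>(1) unfolding lip_approximable_def by blast
  then obtain g where g: "\<And>n. Ck_on k (g n) UNIV" "\<And>n x. \<bar>w x - g n x\<bar> \<le> \<eta> n"
    and glip: "\<And>n r M. r > 0 \<Longrightarrow> M-lipschitz_on (cball 0 (r + \<eta> n)) w \<Longrightarrow>
      (M + \<eta> n)-lipschitz_on (cball 0 r) (g n)"
    by metis

  define T where "T n = {x. l (n + 2) < q x \<and> q x < a n}" for n
  have contq: "continuous_on UNIV q"
    using q(1) by (rule lipschitz_on_continuous_on)
  have openT: "open (T n)" for n
    unfolding T_def by (intro open_Collect_conj open_Collect_less contq continuous_on_const)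
  have openU: "open {x. q x > 0}"
    by (intro open_Collect_less contq continuous_on_const)
  have T_ball: "T n \<subseteq> cball 0 (r n)" for n
  proof
    fix x assume "x \<in> T n"
    then have "l (n + 2) < 1 / (2 + norm x)"
      using q(2)[of x] by (simp add: T_def)
    then have "1 / r n < 1 / (2 + norm x)"
      by (simp add: l_def r_def power_one_over)
    moreover have "r n > 0" "2 + norm x > 0"
      by (auto simp: r_def add_pos_nonneg)
    ultimately have "2 + norm x < r n"
      by (simp add: field_simps)
    then show "x \<in> cball 0 (r n)" by simp
  qed

  define P where "P n x = \<phi> n x * g n x + (1 - \<phi> n x) * g (Suc n) x" for n x
  define v where "v x = P (LEAST n. l (n + 2) < q x) x" for x
  have least: "l ((LEAST n. l (n + 2) < q x) + 2) < q x" if pos: "q x > 0" for x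
  proof -
    obtain n where "l n < q x"
      unfolding l_def using real_arch_pow_inv[OF pos, of "1 / 2"] by auto
    then have "l (n + 2) < q x"
      using ldec[of n "n + 2"] by linarith
    then show ?thesis by (rule LeastI)
  qed
  have cover: "x \<in> T (LEAST n. l (n + 2) < q x)" if "q x > 0" for x
  proof (cases "LEAST n. l (n + 2) < q x")
    case 0
    have "1 / (2 + norm x) \<le> 1 / 2"
      by (intro divide_left_mono) (auto intro: add_pos_nonneg)
    then have "q x \<le> 1 / 2"
      using q(2)[of x] by simp
    then have "q x < a 0"
      by (simp add: a_def l_def)
    then show ?thesis
      using least[OF that] unfolding T_def 0 by simp
  next
    case (Suc m)
    then have "\<not> l (m + 2) < q x"
      using not_less_Least[of m "\<lambda>n. l (n + 2) < q x"] by simp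
    then have "q x < a (Suc m)"
      using la(1)[of "Suc m"] by simp
    then show ?thesis
      using least[OF that] unfolding T_def Suc by simp
  qed
  have v_eq: "v x = P n x" if x: "x \<in> T n" for n x
  proof -
    define m where "m = (LEAST n. l (n + 2) < q x)"
    have qx: "l (n + 2) < q x" "q x < a n"
      using x by (auto simp: T_def)
    have "m \<le> n"
      unfolding m_def by (rule Least_le) (rule qx)
    have "q x > 0"
      using qx(1) l0[of "n + 2"] by linarith
    then have m: "l (m + 2) < q x"
      unfolding m_def by (rule least)
    then have "l (m + 2) < l n"
      using qx(2) la(2)[of n] by linarith
    then have "n < m + 2"
      using ldec[of "m + 2" n] by (meson not_le)
    with \<open>m \<le> n\<close> consider "n = m" | "n = Suc m" by linarith
    then show ?thesis
    proof cases
      case 1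
      then show ?thesis unfolding v_def m_def[symmetric] by simp
    next
      case 2
      have "\<phi> n x = 1" using m 2 by (intro \<phi>1) simp
      moreover have "\<phi> m x = 0" using qx 2 by (intro \<phi>0) simp
      ultimately show ?thesis
        using 2 unfolding v_def m_def[symmetric] P_def by simp
    qed
  qed
  have P_Ck: "Ck_on k (P n) UNIV" for n
  proof -
    have "Ck_on k (\<lambda>x. \<phi> n x * (1 * g n x + (-1) * g (Suc n) x)) UNIV"
      by (intro Ck_on_mult Ck_on_lincomb \<phi> g open_UNIV)
    then have "Ck_on k (\<lambda>x. 1 * (\<phi> n x * (1 * g n x + (-1) * g (Suc n) x)) + 1 * g (Suc n) x) UNIV"
      by (intro Ck_on_lincomb g open_UNIV)
    then show ?thesis
      by (rule Ck_on_cong[OF open_UNIV, rotated]) (simp add: P_def algebra_simps)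
  qed
  have P_lip: "K-lipschitz_on (T n) (P n)" for n
  proof (rule lipschitz_onI)
    show "K \<ge> 0" using w(1) by (rule lipschitz_on_nonneg)
    fix x y assume xy: "x \<in> T n" "y \<in> T n"
    let ?d = "dist x y" and ?e = "\<eta> n + \<eta> (Suc n)"
    have r: "r n > 0" by (simp add: r_def)
    have "(L n + \<eta> i)-lipschitz_on (T n) (g i)" if "i = n \<or> i = Suc n" for i
    proof -
      have "(L n)-lipschitz_on (cball 0 (r n + \<eta> i)) w"
        using L(2) by (rule lipschitz_on_subset) (use \<eta>(2)[of i] in auto)
      from glip[OF r this] show ?thesis
        using T_ball by (rule lipschitz_on_subset)
    qed
    from this[THEN lipschitz_onD, OF _ xy]
    have "\<bar>g i x - g i y\<bar> \<le> (L n + \<eta> i) * ?d" if "i = n \<or> i = Suc n" for i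
      using that by (simp add: dist_real_def)
    moreover have "(L n + \<eta> i) * ?d \<le> (L n + ?e) * ?d" if "i = n \<or> i = Suc n" for i
      using that \<eta>(1)[of n] \<eta>(1)[of "Suc n"] by (intro mult_right_mono) auto
    ultimately have gi: "\<bar>g i x - g i y\<bar> \<le> (L n + ?e) * ?d" if "i = n \<or> i = Suc n" for i
      using that order_trans by blast
    have "\<bar>\<phi> n x * (g n x - g n y) + (1 - \<phi> n x) * (g (Suc n) x - g (Suc n) y)\<bar>
        \<le> \<phi> n x * \<bar>g n x - g n y\<bar> + (1 - \<phi> n x) * \<bar>g (Suc n) x - g (Suc n) y\<bar>"
      using \<phi>(3)[of n x] \<phi>(4)[of n x] by (intro order_trans[OF abs_triangle_ineq]) (simp add: abs_mult)
    also have "\<dots> \<le> \<phi> n x * ((L n + ?e) * ?d) + (1 - \<phi> n x) * ((L n + ?e) * ?d)"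
      using \<phi>(3)[of n x] \<phi>(4)[of n x] gi by (intro add_mono mult_left_mono) auto
    also have "\<dots> = (L n + ?e) * ?d" by (simp add: algebra_simps)
    finally have 1: "\<bar>\<phi> n x * (g n x - g n y) + (1 - \<phi> n x) * (g (Suc n) x - g (Suc n) y)\<bar> \<le> (L n + ?e) * ?d" .
    have "\<bar>\<phi> n x - \<phi> n y\<bar> \<le> M n * ?d"
      using lipschitz_onD[OF \<phi>(2)[of n], of x y] by (simp add: dist_real_def)
    moreover have "\<bar>g n y - g (Suc n) y\<bar> \<le> ?e"
      using g(2)[of y n] g(2)[of y "Suc n"] by linarith
    ultimately have 2: "\<bar>(\<phi> n x - \<phi> n y) * (g n y - g (Suc n) y)\<bar> \<le> M n * ?d * ?e"
      unfolding abs_mult using M[of n] by (intro mult_mono) auto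
    \<comment> \<open>Splitting the difference so that the weights at \<open>x\<close> multiply increments of \<open>g n\<close> and \<open>g (n + 1)\<close>.\<close>
    have "P n x - P n y = (\<phi> n x * (g n x - g n y) + (1 - \<phi> n x) * (g (Suc n) x - g (Suc n) y)) +
      (\<phi> n x - \<phi> n y) * (g n y - g (Suc n) y)"
      by (simp add: P_def algebra_simps)
    then have "\<bar>P n x - P n y\<bar> \<le> (L n + ?e) * ?d + M n * ?d * ?e"
      using 1 2 by linarith
    also have "\<dots> = (L n + (1 + M n) * ?e) * ?d"
      by (simp add: algebra_simps)
    also have "\<dots> \<le> K * ?d"
    proof (intro mult_right_mono)
      have "(1 + M n) * ?e \<le> (1 + M n) * (\<beta> n + \<beta> n)"
        using \<eta>(5)[of n] \<eta>(6)[of n] M[of n] by (intro mult_left_mono) auto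
      also have "\<dots> = K - L n"
        using \<beta>(2)[of n] by (simp add: distrib_left)
      finally show "L n + (1 + M n) * ?e \<le> K" by simp
    qed simp
    finally show "dist (P n x) (P n y) \<le> K * ?d"
      by (simp add: dist_real_def)
  qed
  have P_close: "\<bar>w x - P n x\<bar> \<le> max (\<eta> n) (\<eta> (Suc n))" for n x
  proof -
    have "w x - P n x = \<phi> n x * (w x - g n x) + (1 - \<phi> n x) * (w x - g (Suc n) x)"
      by (simp add: P_def algebra_simps)
    also have "\<bar>\<dots>\<bar> \<le> \<phi> n x * \<bar>w x - g n x\<bar> + (1 - \<phi> n x) * \<bar>w x - g (Suc n) x\<bar>"
      using \<phi>(3)[of n x] \<phi>(4)[of n x] by (intro order_trans[OF abs_triangle_ineq]) (simp add: abs_mult)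
    also have "\<dots> \<le> \<phi> n x * max (\<eta> n) (\<eta> (Suc n)) + (1 - \<phi> n x) * max (\<eta> n) (\<eta> (Suc n))"
      using \<phi>(3)[of n x] \<phi>(4)[of n x] g(2)[of x n] g(2)[of x "Suc n"]
      by (intro add_mono mult_left_mono) auto
    finally show ?thesis by (simp add: algebra_simps)
  qed
  show ?thesis
  proof (rule that)
    show "Ck_on k v {x. q x > 0}"
    proof (rule Ck_on_local[OF openU])
      fix x assume "x \<in> {x. q x > 0}"
      then have "x \<in> T (LEAST n. l (n + 2) < q x)"
        using cover by simp
      moreover have "Ck_on k v (T n)" for n
        by (rule Ck_on_cong[OF openT, of _ "P n"])
          (use v_eq Ck_on_subset[OF open_UNIV openT _ P_Ck] in auto)
      ultimately show "\<exists>V. open V \<and> x \<in> V \<and> Ck_on k v V"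
        using openT by blast
    qed
    fix x assume x: "q x > 0"
    define n where "n = (LEAST n. l (n + 2) < q x)"
    have n: "x \<in> T n"
      unfolding n_def by (rule cover[OF x])
    have close: "\<bar>w x - v x\<bar> \<le> max (\<eta> n) (\<eta> (Suc n))"
      unfolding v_eq[OF n] by (rule P_close)
    show "\<bar>w x - v x\<bar> \<le> \<epsilon>"
      using close \<eta>(3)[of n] \<eta>(3)[of "Suc n"] by linarith
    show "\<bar>w x - v x\<bar> \<le> q x"
      using close \<eta>(4)[of n] \<eta>(4)[of "Suc n"] ldec[of "n + 2" "Suc n + 2"] n
      by (auto simp: T_def)
    have "K-lipschitz_on (T n) v"
      using P_lip[of n] v_eq by (auto simp: lipschitz_on_def)
    then show "\<exists>T. open T \<and> x \<in> T \<and> K-lipschitz_on T v"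
      using openT n by blast
  qed
qed

section \<open>From local to global Lipschitz constants\<close>

text \<open>The bound holds on short pieces of the segment, and it is additive along the segment.\<close>

lemma lipschitz_along_segment:
  fixes v :: "'a::real_normed_vector \<Rightarrow> real"
  assumes "\<And>x. x \<in> U \<Longrightarrow> \<exists>T. open T \<and> x \<in> T \<and> K-lipschitz_on T v"
    and seg: "closed_segment x y \<subseteq> U"
  shows "\<bar>v x - v y\<bar> \<le> K * dist x y"
proof -
  define \<gamma> where "\<gamma> t = x + t *\<^sub>R (y - x)" for t
  have dist: "dist (\<gamma> s) (\<gamma> t) = \<bar>s - t\<bar> * dist x y" for s t
  proof -
    have "\<gamma> s - \<gamma> t = (s - t) *\<^sub>R (y - x)"
      by (simp add: \<gamma>_def algebra_simps)
    then show ?thesis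
      by (simp add: dist_norm norm_minus_commute)
  qed
  have "\<bar>v (\<gamma> 0) - v (\<gamma> 1)\<bar> \<le> K * ((1 - 0) * dist x y)"
  proof (rule Bolzano[of 0 1 "\<lambda>s t. \<bar>v (\<gamma> s) - v (\<gamma> t)\<bar> \<le> K * ((t - s) * dist x y)"])
    fix a b c :: real
    assume *: "\<bar>v (\<gamma> a) - v (\<gamma> b)\<bar> \<le> K * ((b - a) * dist x y)" "\<bar>v (\<gamma> b) - v (\<gamma> c)\<bar> \<le> K * ((c - b) * dist x y)"
    have "K * ((b - a) * dist x y) + K * ((c - b) * dist x y) = K * ((c - a) * dist x y)"
      by (simp add: algebra_simps)
    with * show "\<bar>v (\<gamma> a) - v (\<gamma> c)\<bar> \<le> K * ((c - a) * dist x y)"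
      by linarith
  next
    fix t :: real assume t: "0 \<le> t" "t \<le> 1"
    have "\<gamma> t \<in> closed_segment x y"
      unfolding in_segment using t by (intro exI[of _ t]) (simp add: \<gamma>_def algebra_simps)
    then obtain T where T: "open T" "\<gamma> t \<in> T" "K-lipschitz_on T v"
      using assms(1) seg by blast
    have "isCont \<gamma> t"
      unfolding \<gamma>_def by (intro continuous_intros)
    then have "\<forall>\<^sub>F s in nhds t. \<gamma> s \<in> T"
      using T by (simp add: isCont_def tendsto_def eventually_at_filter) (auto elim: eventually_mono)
    then obtain d where d: "d > 0" "\<And>s. dist s t < d \<Longrightarrow> \<gamma> s \<in> T"
      by (auto simp: eventually_nhds_metric)
    show "\<exists>d>0. \<forall>a b. a \<le> t \<and> t \<le> b \<and> b - a < d \<longrightarrow> \<bar>v (\<gamma> a) - v (\<gamma> b)\<bar> \<le> K * ((b - a) * dist x y)"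
    proof (intro exI conjI allI impI)
      fix a b assume ab: "a \<le> t \<and> t \<le> b \<and> b - a < d"
      then have "\<gamma> a \<in> T" "\<gamma> b \<in> T"
        by (auto intro!: d(2) simp: dist_real_def)
      from lipschitz_onD[OF T(3) this] show "\<bar>v (\<gamma> a) - v (\<gamma> b)\<bar> \<le> K * ((b - a) * dist x y)"
        using ab by (simp add: dist dist_real_def[of "v _"])
    qed (rule d)
  qed simp
  then show ?thesis by (simp add: \<gamma>_def)
qed

text \<open>Let \<open>z\<close> be the point of the segment outside \<open>U\<close> that is nearest to \<open>x\<close>. The segment from \<open>x\<close> to each
  earlier point lies in \<open>U\<close>, and the estimate passes to the limit \<open>z\<close> by continuity on the closure.\<close>

lemma lipschitz_to_first_exit:
  fixes v :: "'a::real_normed_vector \<Rightarrow> real"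
  assumes "open U" "continuous_on (closure U) v"
    and loc: "\<And>x. x \<in> U \<Longrightarrow> \<exists>T. open T \<and> x \<in> T \<and> K-lipschitz_on T v"
    and x: "x \<in> U" and y: "y \<notin> U"
  obtains z where "z \<in> closed_segment x y" "z \<in> frontier U" "\<bar>v x - v z\<bar> \<le> K * dist x z"
proof -
  have "compact (closed_segment x y - U)"
    using assms(1) by (intro compact_diff) auto
  moreover have "closed_segment x y - U \<noteq> {}"
    using y by auto
  moreover have "continuous_on (closed_segment x y - U) (dist x)"
    by (intro continuous_intros)
  ultimately obtain z where z: "z \<in> closed_segment x y" "z \<notin> U"
    and min: "\<And>p. p \<in> closed_segment x y - U \<Longrightarrow> dist x z \<le> dist x p"
    using continuous_attains_inf[of "closed_segment x y - U" "dist x"] by blast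
  define \<gamma> where "\<gamma> t = x + t *\<^sub>R (z - x)" for t
  have c\<gamma>: "continuous_on A \<gamma>" for A
    unfolding \<gamma>_def by (intro continuous_intros)
  have dist: "dist x (\<gamma> t) = t * dist x z" if "t \<ge> 0" for t
    using that by (simp add: \<gamma>_def dist_norm norm_minus_commute)
  have \<gamma>_seg: "\<gamma> t \<in> closed_segment x z" if "0 \<le> t" "t \<le> 1" for t
    unfolding in_segment using that by (intro exI[of _ t]) (simp add: \<gamma>_def algebra_simps)
  have sub: "closed_segment x z \<subseteq> closed_segment x y"
    using z(1) by (simp add: subset_closed_segment)
  have "x \<noteq> z" using x z by blast
  have inU: "p \<in> U" if "p \<in> closed_segment x (\<gamma> t)" "0 \<le> t" "t < 1" for p t
  proof (rule ccontr)
    assume "p \<notin> U"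
    moreover have "p \<in> closed_segment x y"
      using that \<gamma>_seg[of t] sub subset_closed_segment[of x "\<gamma> t" x z] by auto
    ultimately have "dist x z \<le> dist x p" using min by blast
    also have "\<dots> \<le> dist x (\<gamma> t)"
      using segment_bound(1)[OF that(1)] by (simp add: dist_norm norm_minus_commute)
    also have "\<dots> < dist x z"
      using dist[OF that(2)] that(3) \<open>x \<noteq> z\<close> by simp
    finally show False by simp
  qed
  have cl: "closure {0..<1} = {0..1::real}" by simp
  have "\<gamma> ` closure {0..<1} \<subseteq> closure U"
  proof (rule image_closure_subset[OF c\<gamma> closed_closure])
    have "\<gamma> t \<in> U" if "t \<in> {0..<1}" for t
      using inU[of "\<gamma> t" t] that by simp
    then show "\<gamma> ` {0..<1} \<subseteq> closure U"
      using closure_subset[of U] by blast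
  qed
  then have im: "\<gamma> ` {0..1} \<subseteq> closure U" by simp
  have \<gamma>1: "\<gamma> 1 = z" by (simp add: \<gamma>_def)
  have "z \<in> closure U"
    using im \<gamma>1 by force
  then have fr: "z \<in> frontier U"
    using z(2) assms(1) by (simp add: frontier_def interior_open)
  have "0 \<le> K * (1 * dist x z) - \<bar>v x - v (\<gamma> 1)\<bar>"
  proof (rule continuous_ge_on_closure[of "{0..<1}" "\<lambda>t. K * (t * dist x z) - \<bar>v x - v (\<gamma> t)\<bar>" 1 0])
    have "continuous_on {0..1} (\<lambda>t. v (\<gamma> t))"
      by (rule continuous_on_compose2[OF assms(2) c\<gamma> im])
    then show "continuous_on (closure {0..<1}) (\<lambda>t. K * (t * dist x z) - \<bar>v x - v (\<gamma> t)\<bar>)"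
      unfolding cl by (intro continuous_intros)
    fix t :: real assume t: "t \<in> {0..<1}"
    have "\<bar>v x - v (\<gamma> t)\<bar> \<le> K * dist x (\<gamma> t)"
      by (rule lipschitz_along_segment[OF loc]) (use inU t in auto)
    then show "0 \<le> K * (t * dist x z) - \<bar>v x - v (\<gamma> t)\<bar>"
      using dist[of t] t by simp
  qed (simp add: cl)
  then show ?thesis
    using that[OF z(1) fr] \<gamma>1 by simp
qed

text \<open>If the segment between two points \<open>x\<close> and \<open>y\<close> of \<open>U\<close> leaves \<open>U\<close>, cut it at its first exit point \<open>z\<close> from \<open>x\<close>, and cut the
  segment from \<open>y\<close> to \<open>z\<close> at its first exit point from \<open>y\<close>. Both cuts are frontier points on the segment,
  so the three estimates add up to \<open>K * dist x y\<close>.\<close>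

lemma lipschitz_on_closure_of_local:
  fixes v :: "'a::real_normed_vector \<Rightarrow> real"
  assumes "open U" "continuous_on (closure U) v"
    and loc: "\<And>x. x \<in> U \<Longrightarrow> \<exists>T. open T \<and> x \<in> T \<and> K-lipschitz_on T v"
    and fr: "K-lipschitz_on (frontier U) v"
  shows "K-lipschitz_on (closure U) v"
proof (rule lipschitz_onI)
  show "K \<ge> 0" using fr by (rule lipschitz_on_nonneg)
  have seg: "dist a z + dist z b = dist a b" if z: "z \<in> closed_segment a b" for a b z :: 'a
  proof -
    obtain t where t: "0 \<le> t" "t \<le> 1" "z = (1 - t) *\<^sub>R a + t *\<^sub>R b"
      using z by (auto simp: in_segment)
    have "a - z = t *\<^sub>R (a - b)" "z - b = (1 - t) *\<^sub>R (a - b)"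
      unfolding t(3) by (simp_all add: algebra_simps)
    then have "dist a z = t * dist a b" "dist z b = (1 - t) * dist a b"
      using t by (simp_all add: dist_norm)
    then show ?thesis by (simp add: algebra_simps)
  qed
  have frD: "\<bar>v a - v b\<bar> \<le> K * dist a b" if "a \<in> frontier U" "b \<in> frontier U" for a b
    using lipschitz_onD[OF fr that] by (simp add: dist_real_def)
  note exit = lipschitz_to_first_exit[OF assms(1,2) loc]
  have one: "\<bar>v x - v y\<bar> \<le> K * dist x y" if x: "x \<in> U" and y: "y \<in> frontier U" for x y
  proof -
    have "y \<notin> U"
      using y assms(1) by (simp add: frontier_def interior_open)
    then obtain z where z: "z \<in> closed_segment x y" "z \<in> frontier U" "\<bar>v x - v z\<bar> \<le> K * dist x z"
      using exit[OF _ x] by metis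
    have "\<bar>v x - v y\<bar> \<le> K * dist x z + K * dist z y"
      using z(3) frD[OF z(2) y] by linarith
    then show ?thesis
      by (simp add: seg[OF z(1)] flip: distrib_left)
  qed
  have two: "\<bar>v x - v y\<bar> \<le> K * dist x y" if x: "x \<in> U" and y: "y \<in> U" for x y
  proof (cases "closed_segment x y \<subseteq> U")
    case True
    show ?thesis by (rule lipschitz_along_segment[OF loc True])
  next
    case False
    then obtain p where p: "p \<in> closed_segment x y" "p \<notin> U" by blast
    then obtain z where z: "z \<in> closed_segment x p" "z \<in> frontier U" "\<bar>v x - v z\<bar> \<le> K * dist x z"
      using exit[OF _ x] by metis
    have "z \<in> closed_segment x y"
      using p z(1) subset_closed_segment[of x p x y] by auto
    then have "dist x z + dist z y = dist x y" by (rule seg)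
    moreover have "\<bar>v x - v y\<bar> \<le> K * dist x z + K * dist z y"
      using z(3) one[OF y z(2)] by (simp add: dist_commute)
    ultimately show ?thesis
      by (metis distrib_left)
  qed
  fix x y assume "x \<in> closure U" "y \<in> closure U"
  then have "x \<in> U \<or> x \<in> frontier U" "y \<in> U \<or> y \<in> frontier U"
    using assms(1) by (auto simp: frontier_def interior_open)
  then have "\<bar>v x - v y\<bar> \<le> K * dist x y"
    using one[of x y] one[of y x] two frD by (auto simp: dist_commute abs_minus_commute)
  then show "dist (v x) (v y) \<le> K * dist x y"
    by (simp add: dist_real_def)
qed

section \<open>The approximation theorem\<close>

theorem theorem1p4:
  fixes k :: enat
    and \<Omega> :: "'a::banach set"
    and u0 :: "'a \<Rightarrow> real"
    and \<epsilon> :: real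
  assumes approx: "\<And>(f :: 'a \<Rightarrow> real) \<eta>. (\<exists>L. L-lipschitz_on UNIV f) \<Longrightarrow> \<eta> > 0 \<Longrightarrow>
      \<exists>g :: 'a \<Rightarrow> real. Ck_on k g UNIV \<and> (\<forall>x. \<bar>f x - g x\<bar> \<le> \<eta>) \<and>
        (\<forall>x0 r. r > 0 \<longrightarrow> Lip g (cball x0 r) \<le> Lip f (cball x0 (r + \<eta>)) + ereal \<eta>)"
    and "open \<Omega>"
    and "\<exists>L. L-lipschitz_on (closure \<Omega>) u0"
    and "Lip u0 (frontier \<Omega>) < Lip u0 (closure \<Omega>)"
    and "\<epsilon> > 0"
  shows "\<exists>v :: 'a \<Rightarrow> real. Ck_on k v \<Omega> \<and>
      (\<exists>L. L-lipschitz_on (closure \<Omega>) v) \<and> Lip v (closure \<Omega>) \<le> Lip u0 (closure \<Omega>) \<and>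
      (\<forall>x\<in>frontier \<Omega>. v x = u0 x) \<and>
      (\<forall>x\<in>closure \<Omega>. \<bar>u0 x - v x\<bar> \<le> \<epsilon>)"
proof -
  have approximable: "lip_approximable k TYPE('a)"
    using approx by (rule lip_approximableI)

  have Lip_finite: "Lip u0 (closure \<Omega>) \<noteq> \<infinity>" 
    using assms(3) Lip_le_ereal_iff[of _ u0 "closure \<Omega>"] lipschitz_on_nonneg by fastforce
  then obtain K where K: "Lip u0 (closure \<Omega>) = ereal K"
    using Lip_nonneg[of u0 "closure \<Omega>"] by (cases "Lip u0 (closure \<Omega>)") auto
  obtain K0 where K0: "Lip u0 (frontier \<Omega>) = ereal K0"
    using Lip_nonneg[of u0 "frontier \<Omega>"] assms(4) K by (cases "Lip u0 (frontier \<Omega>)") auto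
  have "K0 \<ge> 0" "K0 < K"
    using Lip_nonneg[of u0 "frontier \<Omega>"] assms(4) by (simp_all add: K K0)
  then have u0: "K-lipschitz_on (closure \<Omega>) u0" "K0-lipschitz_on (frontier \<Omega>) u0"
    using Lip_le_ereal_iff[of K u0 "closure \<Omega>"] Lip_le_ereal_iff[of K0 u0 "frontier \<Omega>"] K K0 by auto
  have fr: "frontier \<Omega> \<subseteq> closure \<Omega>" by (simp add: frontier_def)

  obtain w where w: "\<And>R. \<exists>L<K. L-lipschitz_on (cball 0 R) w" "\<And>x. x \<in> frontier \<Omega> \<Longrightarrow> w x = u0 x"
    "\<And>x. x \<in> closure \<Omega> \<Longrightarrow> \<bar>u0 x - w x\<bar> \<le> \<epsilon> / 2"
    using locally_below_constant_approximation[OF u0(1) fr u0(2) \<open>K0 < K\<close> half_gt_zero[OF assms(5)]]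
    by metis
  have w_lip: "K-lipschitz_on UNIV w"
  proof (rule lipschitz_onI)
    fix x y :: 'a
    obtain L where L: "L < K" "L-lipschitz_on (cball 0 (max (norm x) (norm y))) w"
      using w(1) by blast
    have "dist (w x) (w y) \<le> L * dist x y"
      by (rule lipschitz_onD[OF L(2)]) auto
    also have "\<dots> \<le> K * dist x y"
      using L(1) by (intro mult_right_mono) auto
    finally show "dist (w x) (w y) \<le> K * dist x y" .
  qed (use \<open>K0 \<ge> 0\<close> \<open>K0 < K\<close> in simp)

  obtain q :: "'a \<Rightarrow> real" where q: "1-lipschitz_on UNIV q" "\<And>x. q x \<le> 1 / (2 + norm x)"
    "{x. q x > 0} = \<Omega>" "\<And>x. x \<notin> \<Omega> \<Longrightarrow> q x = 0"
    using exhaustion_function_exists[OF assms(2)] by metis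
  have q_pos: "q x > 0 \<longleftrightarrow> x \<in> \<Omega>" for x
    using q(3) by blast
  obtain v0 where v0: "Ck_on k v0 \<Omega>" "\<And>x. x \<in> \<Omega> \<Longrightarrow> \<bar>w x - v0 x\<bar> \<le> \<epsilon> / 2"
    "\<And>x. x \<in> \<Omega> \<Longrightarrow> \<bar>w x - v0 x\<bar> \<le> q x"
    "\<And>x. x \<in> \<Omega> \<Longrightarrow> \<exists>T. open T \<and> x \<in> T \<and> K-lipschitz_on T v0"
    by (rule smooth_perturbation[OF approximable w_lip w(1) q(1,2) half_gt_zero[OF assms(5)], unfolded q_pos Collect_mem_eq])
      blast

  define v where "v x = (if x \<in> \<Omega> then v0 x else w x)" for x
  have v_frontier: "v x = u0 x" if "x \<in> frontier \<Omega>" for x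
    using that w(2) assms(2) by (auto simp: v_def frontier_def interior_open)
  have v_close: "\<bar>w x - v x\<bar> \<le> q x" for x
    using v0(3) q(4) by (simp add: v_def)
  have v_loc: "\<exists>T. open T \<and> x \<in> T \<and> K-lipschitz_on T v" if x: "x \<in> \<Omega>" for x
  proof -
    obtain T where T: "open T" "x \<in> T" "K-lipschitz_on T v0"
      using v0(4)[OF x] by blast
    have "K-lipschitz_on (T \<inter> \<Omega>) v0"
      using T(3) by (rule lipschitz_on_subset) simp
    then have "K-lipschitz_on (T \<inter> \<Omega>) v"
      by (auto simp: lipschitz_on_def v_def)
    then show ?thesis
      using T x assms(2) by (intro exI[of _ "T \<inter> \<Omega>"]) auto
  qed
  \<comment> \<open>Outside \<open>\<Omega>\<close> continuity follows from \<open>\<bar>v - w\<bar> \<le> q\<close>, as \<open>q\<close> vanishes there.\<close>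
  have "isCont v x" for x
  proof (cases "x \<in> \<Omega>")
    case True
    then obtain T where T: "open T" "x \<in> T" "K-lipschitz_on T v"
      using v_loc by blast
    then show ?thesis
      using lipschitz_on_continuous_on[OF T(3)] by (simp add: continuous_on_eq_continuous_at)
  next
    case False
    have cont: "isCont w x" "isCont q x"
      using lipschitz_on_continuous_on[OF w_lip] lipschitz_on_continuous_on[OF q(1)]
      by (simp_all add: continuous_on_eq_continuous_at)
    have "((\<lambda>y. v y - w y) \<longlongrightarrow> 0) (at x)"
    proof (rule Lim_null_comparison[of _ q])
      show "\<forall>\<^sub>F y in at x. norm (v y - w y) \<le> q y"
        using v_close by (simp add: abs_minus_commute)
      show "(q \<longlongrightarrow> 0) (at x)"
        using cont(2) q(4)[OF False] by (simp add: isCont_def)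
    qed
    from tendsto_add[OF this cont(1)[unfolded isCont_def]] have "(v \<longlongrightarrow> w x) (at x)"
      by simp
    moreover have "v x = w x"
      using False by (simp add: v_def)
    ultimately show ?thesis by (simp add: isCont_def)
  qed
  then have "continuous_on (closure \<Omega>) v"
    by (simp add: continuous_at_imp_continuous_on)
  moreover have "K-lipschitz_on (frontier \<Omega>) v"
  proof -
    have "K-lipschitz_on (frontier \<Omega>) u0"
      using u0(1) fr by (rule lipschitz_on_subset)
    then show ?thesis
      using v_frontier by (simp add: lipschitz_on_def)
  qed
  ultimately have v_lip: "K-lipschitz_on (closure \<Omega>) v"
    by (intro lipschitz_on_closure_of_local[OF assms(2) _ v_loc])
  show ?thesis
  proof (intro exI[of _ v] conjI ballI)
    show "Ck_on k v \<Omega>"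
      by (rule Ck_on_cong[OF assms(2) _ v0(1)]) (simp add: v_def)
    show "\<exists>L. L-lipschitz_on (closure \<Omega>) v"
      using v_lip by blast
    show "Lip v (closure \<Omega>) \<le> Lip u0 (closure \<Omega>)"
      unfolding K using v_lip Lip_le_ereal_iff lipschitz_on_nonneg by blast
    show "v x = u0 x" if "x \<in> frontier \<Omega>" for x
      using that by (rule v_frontier)
    show "\<bar>u0 x - v x\<bar> \<le> \<epsilon>" if "x \<in> closure \<Omega>" for x
    proof -
      have "\<bar>w x - v x\<bar> \<le> \<epsilon> / 2"
        using v0(2)[of x] assms(5) by (simp add: v_def)
      then show ?thesis
        using w(3)[OF that] by linarith
    qed
  qed
qed

end
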